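(* Let $\varphi_m=\varphi_{m,n}\in(0,1)$, $m=1,\ldots,M_n$, be penalty factors with $\max_{1\le m\le M_n}\varphi_m\to 0$ as $n\to\infty$. Suppose that (i) there exists a constant $c_1$ (not depending on $n$) such that $$\sum_{m=1}^{M_n}\exp\left[-\frac{(k_m-k_{m-1})\varphi_m^2}{16(1+2\sqrt{\varphi_m})^2}\right]\le c_1;$$ (ii) for all $m=1,\ldots,M_n$, $\displaystyle \frac{1}{k_m-k_{m-1}}\le\frac{1-\varphi_m}{4}$. Let $\hat{\boldsymbol\mu}_{\hat{\mathbf w}|\mathcal M}=\sum_{m=1}^{M_n}\hat\gamma_m\mathbf y_{m|\mathcal M}$ with $$\hat\gamma_m=\left(1-\frac{\sigma^2_{m|\mathcal M}(1+\varphi_m)}{\|\mathbf y_{m|\mathcal M}\|^2}\right)_+,\qquad m=1,\ldots,M_n,$$ be the Stein-type model averaging estimator. Then for any sample size $n$ and any regression mean vector $\boldsymbol\mu$, $$\mathbb E L_n(\hat{\mathbf w}|\mathcal M,\boldsymbol\mu)\le(1+\bar\varphi)\,R_n(\tilde{\mathbf w}^*|\mathcal M,\boldsymbol\mu)+8c_1\sigma^2,$$ where $\bar\varphi=\max_{1\le m\le M_n}\{2\varphi_m+16/[(k_m-k_{m-1})\varphi_m]\}$, $L_n(\hat{\mathbf w}|\mathcal M,\boldsymbol\mu)=\|\hat{\boldsymbol\mu}_{\hat{\mathbf w}|\mathcal M}-\boldsymbol\mu\|^2$, and $R_n(\tilde{\mathbf w}^*|\mathcal M,\boldsymbol\mu)=\min_{\mathbf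 w\in\tilde{\mathcal W}_{M_n}}R_n(\mathbf w|\mathcal M,\boldsymbol\mu)$ is the optimal model averaging risk over the relaxed weight set $\tilde{\mathcal W}_{M_n}$.
   Context: Setting. For each $n$, $\mathbf y=\boldsymbol\mu+\boldsymbol\varepsilon=\mathbf X\boldsymbol\beta+\boldsymbol\varepsilon\in\mathbb R^n$, where $\mathbf X=[\mathbf x_1,\ldots,\mathbf x_{p_n}]$ is a non-random $n\times p_n$ matrix of full column rank, $p_n\le n$, and $\boldsymbol\varepsilon$ has i.i.d. $N(0,\sigma^2)$ entries with $\sigma^2>0$ known. Candidate models. $\mathcal M=\{k_1<k_2<\cdots<k_{M_n}\}$ is a set of integers with $1\le k_1$, $k_{M_n}\le p_n$, $M_n=|\mathcal M|$, and $k_0=0$ (all may depend on $n$). $\mathbf P_{k}$ is the orthogonal projection onto the span of $\mathbf x_1,\ldots,\mathbf x_k$, and $\mathbf P_0=\mathbf 0$. The least-squares estimators are $\hat{\boldsymbol\mu}_{k_m}=\mathbf P_{k_m}\mathbf y$. Block notation. $\mathbf D_{m|\mathcal M}=\mathbf P_{k_m}-\mathbf P_{k_{m-1}}$ for $1\le m\le M_n$; $\mathbf y_{m|\mathcal M}=\mathbf D_{m|\mathcal M}\mathbf y$; $\sigma^2_{m|\mathcal M}=(k_m-k_{m-1})\sigma^2$; $x_+=\max(x,0)$; $\|\cdot\|$ is the Euclidean norm. Averaging and risk. For $\mathbf w\in\mathbb R^{M_n}$, $\hat{\boldsymbol\mu}_{\mathbf w|\mathcal M}=\sum_{m=1}^{M_n}w_m\hat{\boldsymbol\mu}_{k_m}$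 and, for non-random $\mathbf w$, $R_n(\mathbf w|\mathcal M,\boldsymbol\mu)=\mathbb E\|\hat{\boldsymbol\mu}_{\mathbf w|\mathcal M}-\boldsymbol\mu\|^2$. The relaxed weight set is $\tilde{\mathcal W}_{M_n}=\{\mathbf w\in\mathbb R^{M_n}:0\le\sum_{j=m}^{M_n}w_j\le1,\ m=1,\ldots,M_n\}$. The estimator $\sum_m\hat\gamma_m\mathbf y_{m|\mathcal M}$ equals $\hat{\boldsymbol\mu}_{\hat{\mathbf w}|\mathcal M}$ with the random weights $\hat w_m=\hat\gamma_m-\hat\gamma_{m+1}$, $\hat\gamma_{M_n+1}=0$. *)

theory Defs
  imports "HOL-Probability.Probability" "Jordan_Normal_Form.DL_Rank"
begin

(* Vectors and matrices are those of Jordan_Normal_Form, whose dimensions are terms, because the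
   dimensions n and p_n vary along the sequence of models. *)
hide_type (open) Finite_Cartesian_Product.vec
hide_const (open) Finite_Cartesian_Product.mat Finite_Cartesian_Product.vec
unbundle no vec_syntax
no_notation Inner_Product.real_inner_class.inner (infixl "\<bullet>" 70)

definition sq_norm :: "real vec \<Rightarrow> real" where
  "sq_norm v = v \<bullet> v"

(* The projection matrix P_k onto the span of the first k columns of X.  It is the unique matrix
   with this property; for k = 0 the span is {0}, so P_0 = 0. *)
definition orth_proj :: "real mat \<Rightarrow> nat \<Rightarrow> real mat" where
  "orth_proj X k =
     (let n = dim_row X;
          U = LinearCombinations.module.span class_ring (module_vec TYPE(real) n)
                (set (take k (cols X)))
      in THE P. P \<in> carrier_mat n n \<and>
           (\<forall>v \<in> carrier_vec n. P *\<^sub>v v \<in> U \<and> (\<forall>u \<in> U. u \<bullet> (v - P *\<^sub>v v) = 0)))"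

(* For M = {k_1 < ... < k_r}: the size k_m for 1 \<le> m \<le> r, with the convention k_0 = 0. *)
definition cand_size :: "nat set \<Rightarrow> nat \<Rightarrow> nat" where
  "cand_size M m = (0 # sorted_list_of_set M) ! m"

definition block_len :: "nat set \<Rightarrow> nat \<Rightarrow> nat" where
  "block_len M m = cand_size M m - cand_size M (m - 1)"

definition block_vec :: "real mat \<Rightarrow> nat set \<Rightarrow> real vec \<Rightarrow> nat \<Rightarrow> real vec" where
  "block_vec X M y m =
     (orth_proj X (cand_size M m) - orth_proj X (cand_size M (m - 1))) *\<^sub>v y"

definition ls_fit :: "real mat \<Rightarrow> nat \<Rightarrow> real vec \<Rightarrow> real vec" where
  "ls_fit X k y = orth_proj X k *\<^sub>v y"

(* A weight vector (w_1, ..., w_r), r = card M, is a function of which only the values on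
   {1..r} are used. *)
definition averaged_fit :: "real mat \<Rightarrow> nat set \<Rightarrow> (nat \<Rightarrow> real) \<Rightarrow> real vec \<Rightarrow> real vec" where
  "averaged_fit X M w y =
     finsum_vec TYPE(real) (dim_row X)
       (\<lambda>m. w m \<cdot>\<^sub>v ls_fit X (cand_size M m) y) {1..card M}"

definition relaxed_weights :: "nat set \<Rightarrow> (nat \<Rightarrow> real) set" where
  "relaxed_weights M =
     {w. \<forall>m \<in> {1..card M}. 0 \<le> (\<Sum>j = m..card M. w j) \<and> (\<Sum>j = m..card M. w j) \<le> 1}"

definition averaging_risk ::
    "'a measure \<Rightarrow> ('a \<Rightarrow> real vec) \<Rightarrow> real mat \<Rightarrow> nat set \<Rightarrow> real vec \<Rightarrow> (nat \<Rightarrow> real) \<Rightarrow> real" where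
  "averaging_risk \<Omega> \<epsilon> X M \<mu> w =
     (\<integral>\<omega>. sq_norm (averaged_fit X M w (\<mu> + \<epsilon> \<omega>) - \<mu>) \<partial>\<Omega>)"

(* Where the block of y vanishes, division by zero gives the factor the value 1 instead of 0.  This
   is immaterial, because stein_fit multiplies the factor by that block. *)
definition stein_factor ::
    "real \<Rightarrow> (nat \<Rightarrow> real) \<Rightarrow> real mat \<Rightarrow> nat set \<Rightarrow> real vec \<Rightarrow> nat \<Rightarrow> real" where
  "stein_factor \<sigma> \<phi> X M y m =
     max (1 - real (block_len M m) * \<sigma>\<^sup>2 * (1 + \<phi> m) / sq_norm (block_vec X M y m)) 0"

definition stein_fit ::
    "real \<Rightarrow> (nat \<Rightarrow> real) \<Rightarrow> real mat \<Rightarrow> nat set \<Rightarrow> real vec \<Rightarrow> real vec" where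
  "stein_fit \<sigma> \<phi> X M y =
     finsum_vec TYPE(real) (dim_row X)
       (\<lambda>m. stein_factor \<sigma> \<phi> X M y m \<cdot>\<^sub>v block_vec X M y m) {1..card M}"

end

theory Submission
  imports Defs
begin

text \<open>
  The blocks of \<open>y\<close> are mutually orthogonal, so both losses split into a sum over blocks plus the same
  bias term, and the optimal relaxed weights give block \<open>m\<close> the factor \<open>A / (A + v)\<close>, where
  \<open>A\<close> is the squared norm of the mean in the block and \<open>v = d \<sigma>\<^sup>2\<close>, with \<open>d\<close> the length of the block.  It
  remains to compare the risk of one block with \<open>v A / (A + v)\<close>.

  Stein's identity, applied coordinatewise to \<open>D y \<psi>(S)\<close> with \<open>D\<close> the projection onto the block and
  \<open>S\<close> the squared norm of \<open>D y\<close> (so that no rotation to an eigenbasis of \<open>D\<close> is needed), writes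
  the risk as the expectation of a function \<open>W(S)\<close>.  If \<open>A \<ge> \<phi> v / 2\<close>, Jensen's inequality for a concave
  majorant of \<open>W\<close> gives the claim.  If \<open>A < \<phi> v / 2\<close>, then \<open>W(S)\<close> is at most
  \<open>S - v\<close> plus \<open>4 \<sigma>\<^sup>2\<close> on the event \<open>S > (1 + \<phi>) v\<close>, whose probability is bounded by Chernoff's
  method; the moment generating function of \<open>S\<close> satisfies a differential equation, again by
  Stein's identity.
\<close>

text \<open>The obstacle is that \<open>W\<close> is not concave. The Stein factor has a kink at S =
  (1 + \<phi>) v, and the derivative term of Stein's identity makes \<open>W\<close> jump up there
  by 4 \<sigma>^2, which is 4 / d in units of v. The constants come from paying for this jump. With
  A = \<alpha> v the oracle risk is v \<alpha> / (1 + \<alpha>). Once \<alpha> \<ge> \<phi> / 2 this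
  is large enough to pay for the jump at the relative cost 16 / (d \<phi>). For smaller \<alpha> the
  oracle risk may vanish and cannot pay; but then the mean of S, which is v (1 + \<alpha>), stays at
  least \<phi> v / 2 below the jump, so the jump is only met with exponentially small probability.
  Condition (i) sums these probabilities. Condition (ii) reads 4 / d \<le> 1 - \<phi>, which is what
  makes \<open>W\<close> concave beyond the jump.

  Without an eigenbasis the inner product of D \<mu> and D y stays in the formulas as an unknown.
  Stein's identity is therefore stated for (D y + c D \<mu>) \<psi>(S) with a free number c, and
  each use picks the c that isolates or removes this product.\<close>

section \<open>Gaussian integration by parts\<close>

text \<open>The integral of \<open>g\<close> over [-k, k] is H k = G k - G (-k), so \<open>H\<close>
  tends to L. If L were nonzero, |H| would exceed |L| / 2 on a half-line, although \<open>H\<close>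
  is integrable because \<open>G\<close> is. Integrability thus replaces decay of \<open>G\<close>
  at infinity.\<close>

lemma integral_derivative_eq_0:
  fixes G g :: "real \<Rightarrow> real"
  assumes G: "integrable lborel G" and g: "integrable lborel g"
    and cont: "continuous_on UNIV G" and fin: "finite A"
    and deriv: "\<And>x. x \<notin> A \<Longrightarrow> (G has_real_derivative g x) (at x)"
  shows "(\<integral>x. g x \<partial>lborel) = 0"
proof (rule ccontr)
  define L where "L = (\<integral>x. g x \<partial>lborel)"
  assume "(\<integral>x. g x \<partial>lborel) \<noteq> 0"
  then have L: "\<bar>L\<bar> > 0"
    by (simp add: L_def)
  define H where "H k = G k - G (- k)" for k
  have H_eq: "H k = (LINT x|lborel. indicator {- k..k} x *\<^sub>R g x)" if "k \<ge> 0" for k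
  proof -
    have "(g has_integral (G k - G (- k))) {- k..k}"
      using that fin deriv cont
      by (intro fundamental_theorem_of_calculus_strong[where S = A])
        (auto simp: has_real_derivative_iff_has_vector_derivative[symmetric] intro: continuous_on_subset)
    moreover have "set_integrable lborel {- k..k} g"
      unfolding set_integrable_def using g by (intro integrable_mult_indicator) auto
    ultimately show ?thesis
      using set_borel_integral_eq_integral(2)[of "{- k..k}" g]
      by (simp add: H_def set_lebesgue_integral_def integral_unique)
  qed
  have "((\<lambda>k. LINT x|lborel. indicator {- k..k} x *\<^sub>R g x) \<longlongrightarrow> L) at_top"
    unfolding L_def
  proof (rule tendsto_at_topI_sequentially)
    fix Y :: "nat \<Rightarrow> real" assume Y: "filterlim Y at_top sequentially"
    show "(\<lambda>n. LINT x|lborel. indicator {- Y n..Y n} x *\<^sub>R g x) \<longlonglongrightarrow> (LINT x|lborel. g x)"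
    proof (rule integral_dominated_convergence[where w = "\<lambda>x. norm (g x)"])
      show "AE x in lborel. (\<lambda>n. indicator {- Y n..Y n} x *\<^sub>R g x) \<longlonglongrightarrow> g x"
      proof (rule AE_I2)
        fix x :: real
        have "eventually (\<lambda>n. \<bar>x\<bar> \<le> Y n) sequentially"
          using Y by (simp add: filterlim_at_top)
        then show "(\<lambda>n. indicator {- Y n..Y n} x *\<^sub>R g x) \<longlonglongrightarrow> g x"
          by (intro tendsto_eventually, elim eventually_mono) (auto simp: indicator_def)
      qed
    qed (use g in \<open>auto split: split_indicator\<close>)
  qed
  moreover have "eventually (\<lambda>k. (LINT x|lborel. indicator {- k..k} x *\<^sub>R g x) = H k) at_top"
    using eventually_ge_at_top[of 0] by eventually_elim (simp add: H_eq)
  ultimately have "(H \<longlongrightarrow> L) at_top"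
    using filterlim_cong by fast
  then have "((\<lambda>k. \<bar>H k\<bar>) \<longlongrightarrow> \<bar>L\<bar>) at_top"
    by (rule tendsto_rabs)
  then have "eventually (\<lambda>k. \<bar>H k\<bar> > \<bar>L\<bar> / 2) at_top"
    by (rule order_tendstoD) (use L in simp)
  then obtain K where K: "\<And>k. k \<ge> K \<Longrightarrow> \<bar>H k\<bar> > \<bar>L\<bar> / 2"
    by (auto simp: eventually_at_top_linorder)
  have H_int: "integrable lborel (\<lambda>k. \<bar>H k\<bar>)"
  proof -
    have "integrable lborel (\<lambda>k. G (0 + (-1) * k))"
      using G by (subst lborel_integrable_real_affine_iff) auto
    with G show ?thesis
      unfolding H_def by (intro integrable_abs Bochner_Integration.integrable_diff) auto
  qed
  define I where "I = (\<integral>k. \<bar>H k\<bar> \<partial>lborel)"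
  \<comment> \<open>Windows of any length m inside the half-line where |H| > |L| / 2 force the
    integral of |H| above every bound.\<close>
  have I: "real m * (\<bar>L\<bar> / 2) \<le> I" for m :: nat
  proof -
    have "real m * (\<bar>L\<bar> / 2) = (\<integral>k. indicator {K..K + real m} k * (\<bar>L\<bar> / 2) \<partial>lborel)"
      by simp
    also have "\<dots> \<le> I"
      unfolding I_def
    proof (rule integral_mono[OF _ H_int])
      show "integrable lborel (\<lambda>k. indicator {K..K + real m} k * (\<bar>L\<bar> / 2))"
        by (intro integrable_mult_left integrable_real_indicator) auto
      show "indicator {K..K + real m} k * (\<bar>L\<bar> / 2) \<le> \<bar>H k\<bar>" for k
        using K[of k] by (auto simp: indicator_def)
    qed
    finally show ?thesis .
  qed
  obtain m :: nat where "I < real m * (\<bar>L\<bar> / 2)"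
    using reals_Archimedean3[of "\<bar>L\<bar> / 2"] L by auto
  with I show False
    by (simp add: not_le[symmetric])
qed

lemma normal_density_has_derivative:
  "\<sigma> \<noteq> 0 \<Longrightarrow> (normal_density 0 \<sigma> has_real_derivative - x / \<sigma>\<^sup>2 * normal_density 0 \<sigma> x) (at x)"
  unfolding normal_density_def by (auto intro!: derivative_eq_intros simp: field_simps power2_eq_square)

definition normal_measure :: "real \<Rightarrow> real measure" where
  "normal_measure \<sigma> = density lborel (normal_density 0 \<sigma>)"

lemma sets_normal_measure [measurable_cong, simp]: "sets (normal_measure \<sigma>) = sets borel"
  and space_normal_measure [simp]: "space (normal_measure \<sigma>) = UNIV"
  by (simp_all add: normal_measure_def)

lemma prob_space_normal_measure: "\<sigma> > 0 \<Longrightarrow> prob_space (normal_measure \<sigma>)"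
  unfolding normal_measure_def by (rule prob_space_normal_density)

lemma integrable_normal_measure_iff:
  fixes f :: "real \<Rightarrow> real"
  assumes "f \<in> borel_measurable borel"
  shows "integrable (normal_measure \<sigma>) f \<longleftrightarrow> integrable lborel (\<lambda>x. normal_density 0 \<sigma> x * f x)"
  unfolding normal_measure_def using assms by (subst integrable_real_density) auto

lemma integral_normal_measure:
  fixes f :: "real \<Rightarrow> real"
  assumes "f \<in> borel_measurable borel"
  shows "(\<integral>x. f x \<partial>normal_measure \<sigma>) = (\<integral>x. normal_density 0 \<sigma> x * f x \<partial>lborel)"
  unfolding normal_measure_def using assms by (subst integral_real_density) auto

text \<open>The density p satisfies p' = - x p / \<sigma>^2, so (p u)' = p u' - x p u / \<sigma>^2,
  and this derivative integrates to 0. The exceptional set \<open>A\<close> makes room for the kink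
  of the Stein factor.\<close>

lemma stein_identity_real:
  fixes u u' :: "real \<Rightarrow> real"
  assumes \<sigma>: "\<sigma> > 0"
    and u: "integrable (normal_measure \<sigma>) u"
    and xu: "integrable (normal_measure \<sigma>) (\<lambda>x. x * u x)"
    and u': "integrable (normal_measure \<sigma>) u'"
    and cont: "continuous_on UNIV u" and fin: "finite A"
    and deriv: "\<And>x. x \<notin> A \<Longrightarrow> (u has_real_derivative u' x) (at x)"
  shows "(\<integral>x. x * u x \<partial>normal_measure \<sigma>) = \<sigma>\<^sup>2 * (\<integral>x. u' x \<partial>normal_measure \<sigma>)"
proof -
  let ?p = "normal_density 0 \<sigma>"
  have [measurable]: "u \<in> borel_measurable borel" "u' \<in> borel_measurable borel"
    using u u' by (auto dest!: borel_measurable_integrable cong: measurable_cong_sets)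
  have i: "integrable lborel (\<lambda>x. ?p x * u x)" "integrable lborel (\<lambda>x. ?p x * (x * u x))"
    "integrable lborel (\<lambda>x. ?p x * u' x)"
    using u xu u' by (simp_all add: integrable_normal_measure_iff)
  have "(\<integral>x. ?p x * u' x - (1 / \<sigma>\<^sup>2) * (?p x * (x * u x)) \<partial>lborel) = 0"
  proof (rule integral_derivative_eq_0[OF i(1) _ _ fin])
    show "integrable lborel (\<lambda>x. ?p x * u' x - (1 / \<sigma>\<^sup>2) * (?p x * (x * u x)))"
      using i by simp
    have "continuous_on UNIV ?p"
      unfolding normal_density_def using \<sigma> by (intro continuous_intros) auto
    with cont show "continuous_on UNIV (\<lambda>x. ?p x * u x)"
      by (intro continuous_intros)
    show "((\<lambda>x. ?p x * u x) has_real_derivative ?p x * u' x - (1 / \<sigma>\<^sup>2) * (?p x * (x * u x))) (at x)"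
      if "x \<notin> A" for x
      using DERIV_mult[OF normal_density_has_derivative[of \<sigma> x] deriv[OF that]] \<sigma>
      by (simp add: algebra_simps)
  qed
  with i have "(\<integral>x. ?p x * u' x \<partial>lborel) = (1 / \<sigma>\<^sup>2) * (\<integral>x. ?p x * (x * u x) \<partial>lborel)"
    by simp
  with \<sigma> show ?thesis
    by (simp add: integral_normal_measure)
qed

text \<open>The Gaussian decay beats the exponent \<tau> by \<alpha>. Half of \<alpha> absorbs the
  linear term created by the shift \<open>m\<close>; the other half is the decay of a normal density
  with variance 1 / \<alpha>.\<close>

lemma integrable_exp_square_normal:
  assumes \<sigma>: "\<sigma> > 0" and \<tau>: "\<tau> < 1 / (2 * \<sigma>\<^sup>2)"
  shows "integrable (normal_measure \<sigma>) (\<lambda>x. exp (\<tau> * (m + x)\<^sup>2))"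
proof -
  define \<alpha> where "\<alpha> = 1 / (2 * \<sigma>\<^sup>2) - \<tau>"
  have \<alpha>: "\<alpha> > 0"
    using \<tau> by (simp add: \<alpha>_def)
  define s where "s = 1 / sqrt \<alpha>"
  have s: "s > 0" "s\<^sup>2 = 1 / \<alpha>"
    using \<alpha> by (simp_all add: s_def power_divide)
  define C where "C = exp (2 * \<tau>\<^sup>2 * m\<^sup>2 / \<alpha> + \<tau> * m\<^sup>2) * sqrt (2 * pi * s\<^sup>2) / sqrt (2 * pi * \<sigma>\<^sup>2)"
  have bound: "normal_density 0 \<sigma> x * exp (\<tau> * (m + x)\<^sup>2) \<le> C * normal_density 0 s x" for x
  proof -
    have sq: "- x\<^sup>2 / (2 * \<sigma>\<^sup>2) = - (\<alpha> + \<tau>) * x\<^sup>2"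
      by (simp add: \<alpha>_def)
    have "0 \<le> (\<alpha> * x - 2 * \<tau> * m)\<^sup>2 / (2 * \<alpha>)"
      using \<alpha> by simp
    also have "\<dots> = \<alpha> * x\<^sup>2 / 2 + 2 * \<tau>\<^sup>2 * m\<^sup>2 / \<alpha> - 2 * \<tau> * m * x"
      using \<alpha> by (simp add: power2_eq_square field_simps)
    finally have "- x\<^sup>2 / (2 * \<sigma>\<^sup>2) + \<tau> * (m + x)\<^sup>2 \<le> - \<alpha> * x\<^sup>2 / 2 + (2 * \<tau>\<^sup>2 * m\<^sup>2 / \<alpha> + \<tau> * m\<^sup>2)"
      unfolding sq by (simp add: power2_eq_square algebra_simps)
    also have "- \<alpha> * x\<^sup>2 / 2 = - x\<^sup>2 / (2 * s\<^sup>2)"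
      using \<alpha> by (simp add: s)
    finally have "exp (- x\<^sup>2 / (2 * \<sigma>\<^sup>2)) * exp (\<tau> * (m + x)\<^sup>2)
        \<le> exp (- x\<^sup>2 / (2 * s\<^sup>2)) * exp (2 * \<tau>\<^sup>2 * m\<^sup>2 / \<alpha> + \<tau> * m\<^sup>2)"
      by (simp add: exp_add[symmetric])
    then show ?thesis
      using \<sigma> s(1) by (simp add: normal_density_def C_def field_simps)
  qed
  have C: "C \<ge> 0"
    by (simp add: C_def)
  have "integrable lborel (\<lambda>x. normal_density 0 \<sigma> x * exp (\<tau> * (m + x)\<^sup>2))"
    by (rule Bochner_Integration.integrable_bound[where f = "\<lambda>x. C * normal_density 0 s x"])
      (use C s(1) bound in auto)
  then show ?thesis
    by (simp add: integrable_normal_measure_iff)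
qed

text \<open>The canonical space of the noise, on which one coordinate can be varied by
  \<open>x(i := r)\<close>. \<open>noise_integral\<close> transports expectations to it from an
  arbitrary probability space.\<close>

definition noise_measure :: "nat \<Rightarrow> real \<Rightarrow> (nat \<Rightarrow> real) measure" where
  "noise_measure n \<sigma> = (\<Pi>\<^sub>M i\<in>{..<n}. normal_measure \<sigma>)"

lemma prob_space_noise_measure: "\<sigma> > 0 \<Longrightarrow> prob_space (noise_measure n \<sigma>)"
  unfolding noise_measure_def by (intro prob_space_PiM prob_space_normal_measure)

lemma measurable_noise_component [measurable]:
  "i < n \<Longrightarrow> (\<lambda>x. x i) \<in> borel_measurable (noise_measure n \<sigma>)"
  unfolding noise_measure_def by measurable

text \<open>Fubini's theorem with coordinate \<open>i\<close> split off; a slice is integrable only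
  for almost every choice of the other coordinates.\<close>

lemma noise_measure_slices:
  fixes h :: "(nat \<Rightarrow> real) \<Rightarrow> real"
  assumes \<sigma>: "\<sigma> > 0" and i: "i < n" and h: "integrable (noise_measure n \<sigma>) h"
  defines "P \<equiv> \<Pi>\<^sub>M j\<in>{..<n} - {i}. normal_measure \<sigma>"
  shows "AE x in P. integrable (normal_measure \<sigma>) (\<lambda>r. h (x(i := r)))"
    and "(\<integral>x. h x \<partial>noise_measure n \<sigma>) = (\<integral>x. (\<integral>r. h (x(i := r)) \<partial>normal_measure \<sigma>) \<partial>P)"
proof -
  let ?N = "normal_measure \<sigma>" and ?Q = "noise_measure n \<sigma>"
  interpret N: prob_space ?N
    using \<sigma> by (rule prob_space_normal_measure)
  interpret P: prob_space P
    unfolding P_def by (intro prob_space_PiM prob_space_normal_measure \<sigma>)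
  interpret pair_sigma_finite ?N P ..
  have ins: "insert i ({..<n} - {i}) = {..<n}"
    using i by auto
  have Q: "distr (?N \<Otimes>\<^sub>M P) ?Q (\<lambda>(r, x). x(i := r)) = ?Q"
    using distr_pair_PiM_eq_PiM[of "{..<n} - {i}" "\<lambda>_. ?N" i] prob_space_normal_measure[OF \<sigma>]
    unfolding P_def noise_measure_def ins by simp
  have meas: "(\<lambda>(r, x). x(i := r)) \<in> measurable (?N \<Otimes>\<^sub>M P) ?Q"
  proof -
    have "(\<lambda>(r, x). x(i := r)) \<in> measurable (?N \<Otimes>\<^sub>M P) (Pi\<^sub>M (insert i ({..<n} - {i})) (\<lambda>_. ?N))"
      unfolding P_def by measurable
    then show ?thesis
      by (simp only: ins noise_measure_def)
  qed
  have [measurable]: "h \<in> borel_measurable ?Q"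
    using h by simp
  have int: "integrable (?N \<Otimes>\<^sub>M P) (case_prod (\<lambda>r x. h (x(i := r))))"
    using h integrable_distr_eq[OF meas, of h] unfolding Q by (simp add: split_def)
  then show "AE x in P. integrable ?N (\<lambda>r. h (x(i := r)))"
    by (rule AE_integrable_snd)
  have "(\<integral>x. h x \<partial>?Q) = (\<integral>z. h (case_prod (\<lambda>r x. x(i := r)) z) \<partial>(?N \<Otimes>\<^sub>M P))"
    using integral_distr[OF meas, of h] unfolding Q by simp
  also have "\<dots> = (\<integral>x. (\<integral>r. h (x(i := r)) \<partial>?N) \<partial>P)"
    using integral_snd[OF int] by (simp add: split_def)
  finally show "(\<integral>x. h x \<partial>?Q) = (\<integral>x. (\<integral>r. h (x(i := r)) \<partial>?N) \<partial>P)" .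
qed

text \<open>On almost every slice the one-dimensional identity makes the integral of x i * F -
  \<sigma>^2 * G vanish, and Fubini does the rest. The exceptional set may differ from slice to
  slice.\<close>

lemma stein_identity_coordinate:
  fixes F G :: "(nat \<Rightarrow> real) \<Rightarrow> real"
  assumes \<sigma>: "\<sigma> > 0" and i: "i < n"
    and F: "integrable (noise_measure n \<sigma>) F"
    and xF: "integrable (noise_measure n \<sigma>) (\<lambda>x. x i * F x)"
    and G: "integrable (noise_measure n \<sigma>) G"
    and cont: "\<And>x. continuous_on UNIV (\<lambda>r. F (x(i := r)))"
    and deriv: "\<And>x. \<exists>A. finite A \<and>
      (\<forall>r. r \<notin> A \<longrightarrow> ((\<lambda>r. F (x(i := r))) has_real_derivative G (x(i := r))) (at r))"
  shows "(\<integral>x. x i * F x \<partial>noise_measure n \<sigma>) = \<sigma>\<^sup>2 * (\<integral>x. G x \<partial>noise_measure n \<sigma>)"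
proof -
  let ?N = "normal_measure \<sigma>" and ?Q = "noise_measure n \<sigma>"
  define P where "P = (\<Pi>\<^sub>M j\<in>{..<n} - {i}. ?N)"
  have xFG: "integrable ?Q (\<lambda>x. x i * F x - \<sigma>\<^sup>2 * G x)"
    using xF G by simp
  have "AE x in P. (\<integral>r. r * F (x(i := r)) - \<sigma>\<^sup>2 * G (x(i := r)) \<partial>?N) = 0"
    using noise_measure_slices(1)[OF \<sigma> i F, folded P_def]
      noise_measure_slices(1)[OF \<sigma> i xF, folded P_def]
      noise_measure_slices(1)[OF \<sigma> i G, folded P_def]
  proof eventually_elim
    case (elim x)
    obtain A where "finite A"
      and "\<And>r. r \<notin> A \<Longrightarrow> ((\<lambda>r. F (x(i := r))) has_real_derivative G (x(i := r))) (at r)"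
      using deriv[of x] by blast
    with elim cont[of x] show ?case
      using stein_identity_real[OF \<sigma>, of "\<lambda>r. F (x(i := r))" "\<lambda>r. G (x(i := r))" A] by simp
  qed
  then have "(\<integral>x. x i * F x - \<sigma>\<^sup>2 * G x \<partial>?Q) = 0"
    unfolding noise_measure_slices(2)[OF \<sigma> i xFG, folded P_def]
    by (subst integral_eq_zero_AE) (auto elim!: eventually_mono)
  with xF G show ?thesis
    by simp
qed

text \<open>A slightly larger exponent \<tau>', still subcritical, absorbs the polynomial factor,
  and the exponential of the sum of squares factorises over the independent coordinates.\<close>

lemma integrable_noise_bound:
  fixes f :: "(nat \<Rightarrow> real) \<Rightarrow> real"
  assumes \<sigma>: "\<sigma> > 0" and \<tau>: "\<tau> < 1 / (2 * \<sigma>\<^sup>2)"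
    and f: "f \<in> borel_measurable (noise_measure n \<sigma>)"
    and bound: "\<And>x. \<bar>f x\<bar> \<le> K * (1 + (\<Sum>i<n. (\<mu> i + x i)\<^sup>2)) * exp (\<tau> * (\<Sum>i<n. (\<mu> i + x i)\<^sup>2))"
  shows "integrable (noise_measure n \<sigma>) f"
proof -
  interpret product_sigma_finite "\<lambda>_::nat. normal_measure \<sigma>"
    by (intro product_sigma_finite.intro prob_space_imp_sigma_finite prob_space_normal_measure \<sigma>)
  obtain \<tau>' where \<tau>': "\<tau> < \<tau>'" "\<tau>' < 1 / (2 * \<sigma>\<^sup>2)"
    using dense[OF \<tau>] by blast
  define C where "C = \<bar>K\<bar> * (1 + 1 / (\<tau>' - \<tau>))"
  let ?T = "\<lambda>x. \<Sum>i<n. (\<mu> i + x i)\<^sup>2"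
  have "integrable (noise_measure n \<sigma>) (\<lambda>x. \<Prod>i<n. exp (\<tau>' * (\<mu> i + x i)\<^sup>2))"
    unfolding noise_measure_def
    by (intro product_integrable_prod integrable_exp_square_normal \<sigma> \<tau>') simp
  then have "integrable (noise_measure n \<sigma>) (\<lambda>x. C * exp (\<tau>' * ?T x))"
    by (simp add: exp_sum sum_distrib_left)
  then show ?thesis
  proof (rule Bochner_Integration.integrable_bound[OF _ f], intro AE_I2)
    fix x
    have T: "?T x \<ge> 0"
      by (simp add: sum_nonneg)
    have "(\<tau>' - \<tau>) * ?T x \<le> exp ((\<tau>' - \<tau>) * ?T x)"
      using exp_ge_add_one_self[of "(\<tau>' - \<tau>) * ?T x"] by linarith
    then have "?T x \<le> 1 / (\<tau>' - \<tau>) * exp ((\<tau>' - \<tau>) * ?T x)"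
      using \<tau>' by (simp add: field_simps)
    moreover have "1 \<le> exp ((\<tau>' - \<tau>) * ?T x)"
      using T \<tau>' by simp
    ultimately have *: "1 + ?T x \<le> (1 + 1 / (\<tau>' - \<tau>)) * exp ((\<tau>' - \<tau>) * ?T x)"
      unfolding distrib_right mult_1 by linarith
    have "\<bar>f x\<bar> \<le> \<bar>K\<bar> * (1 + ?T x) * exp (\<tau> * ?T x)"
      by (rule order_trans[OF bound]) (use T in \<open>intro mult_right_mono; simp\<close>)
    also have "\<dots> \<le> \<bar>K\<bar> * ((1 + 1 / (\<tau>' - \<tau>)) * exp ((\<tau>' - \<tau>) * ?T x)) * exp (\<tau> * ?T x)"
      by (intro mult_right_mono mult_left_mono *) auto
    also have "\<dots> = C * exp (\<tau>' * ?T x)"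
      by (simp add: C_def exp_add[symmetric] algebra_simps)
    finally show "norm (f x) \<le> norm (C * exp (\<tau>' * ?T x))"
      by simp
  qed
qed

section \<open>Stein's identity for projections of Gaussian noise\<close>

text \<open>An orthogonal projection enters only as a symmetric idempotent array. All geometry then
  follows from <u, D v> = <D u, v> and D D = D.\<close>

locale noisy_projection =
  fixes n :: nat and D :: "nat \<Rightarrow> nat \<Rightarrow> real" and \<mu> :: "nat \<Rightarrow> real" and \<sigma> :: real
  assumes sigma_pos: "\<sigma> > 0"
    and sym: "\<And>i j. i < n \<Longrightarrow> j < n \<Longrightarrow> D i j = D j i"
    and idem: "\<And>i j. i < n \<Longrightarrow> j < n \<Longrightarrow> (\<Sum>k<n. D i k * D k j) = D i j"
begin

abbreviation "Q \<equiv> noise_measure n \<sigma>"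

definition proj :: "(nat \<Rightarrow> real) \<Rightarrow> nat \<Rightarrow> real" where
  "proj v i = (\<Sum>j<n. D i j * v j)"

text \<open>The trace of an orthogonal projection is its rank, so this is the number of degrees of
  freedom of \<open>energy\<close>.\<close>

definition tr :: real where
  "tr = (\<Sum>i<n. D i i)"

definition \<theta> :: "nat \<Rightarrow> real" where
  "\<theta> = proj \<mu>"

definition signal :: real where
  "signal = (\<Sum>i<n. (\<theta> i)\<^sup>2)"

definition obs :: "(nat \<Rightarrow> real) \<Rightarrow> nat \<Rightarrow> real" where
  "obs x = proj (\<lambda>i. \<mu> i + x i)"

definition energy :: "(nat \<Rightarrow> real) \<Rightarrow> real" where
  "energy x = (\<Sum>i<n. (obs x i)\<^sup>2)"

definition cross :: "(nat \<Rightarrow> real) \<Rightarrow> real" where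
  "cross x = (\<Sum>i<n. \<theta> i * obs x i)"

text \<open>The scale for all integrability bounds: unlike that of \<open>energy\<close>, its
  exponential factorises over the coordinates.\<close>

definition total :: "(nat \<Rightarrow> real) \<Rightarrow> real" where
  "total x = (\<Sum>i<n. (\<mu> i + x i)\<^sup>2)"

lemma prob_space_Q: "prob_space Q"
  by (rule prob_space_noise_measure[OF sigma_pos])

lemma sum_proj_swap: "(\<Sum>i<n. u i * proj v i) = (\<Sum>i<n. proj u i * v i)"
proof -
  have "(\<Sum>i<n. u i * proj v i) = (\<Sum>i<n. \<Sum>j<n. u j * (D j i * v i))"
    unfolding proj_def sum_distrib_left by (rule sum.swap)
  also have "\<dots> = (\<Sum>i<n. proj u i * v i)"
    unfolding proj_def sum_distrib_right
  proof (intro sum.cong refl)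
    fix i j assume "i \<in> {..<n}" "j \<in> {..<n}"
    then show "u j * (D j i * v i) = D i j * u j * v i"
      using sym[of i j] by simp
  qed
  finally show ?thesis .
qed

lemma proj_proj: "i < n \<Longrightarrow> proj (proj v) i = proj v i"
proof -
  assume i: "i < n"
  have "proj (proj v) i = (\<Sum>k<n. \<Sum>j<n. D i k * (D k j * v j))"
    by (simp add: proj_def sum_distrib_left)
  also have "\<dots> = (\<Sum>j<n. \<Sum>k<n. D i k * (D k j * v j))"
    by (rule sum.swap)
  also have "\<dots> = (\<Sum>j<n. (\<Sum>k<n. D i k * D k j) * v j)"
    by (simp add: sum_distrib_right mult.assoc)
  also have "\<dots> = proj v i"
    using i by (simp add: proj_def idem)
  finally show ?thesis .
qed

lemma sum_proj_proj: "(\<Sum>i<n. proj u i * proj v i) = (\<Sum>i<n. proj u i * v i)"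
proof -
  have "(\<Sum>i<n. proj u i * proj v i) = (\<Sum>i<n. proj (proj u) i * v i)"
    by (rule sum_proj_swap)
  then show ?thesis
    by (simp add: proj_proj)
qed

lemma energy_nonneg: "energy x \<ge> 0"
  by (simp add: energy_def sum_nonneg)

lemma signal_nonneg: "signal \<ge> 0"
  by (simp add: signal_def sum_nonneg)

lemma total_nonneg: "total x \<ge> 0"
  by (simp add: total_def sum_nonneg)

lemma energy_eq: "energy x = (\<Sum>i<n. obs x i * (\<mu> i + x i))"
  unfolding energy_def obs_def power2_eq_square by (rule sum_proj_proj)

lemma cross_eq: "cross x = (\<Sum>i<n. obs x i * \<mu> i)"
  unfolding cross_def obs_def \<theta>_def using sum_proj_proj[of "\<lambda>i. \<mu> i + x i" \<mu>]
  by (simp add: mult.commute)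

lemma signal_eq: "signal = (\<Sum>i<n. \<theta> i * \<mu> i)"
  unfolding signal_def \<theta>_def power2_eq_square by (rule sum_proj_proj)

lemma sum_obs_noise: "(\<Sum>i<n. obs x i * x i) = energy x - cross x"
  by (simp add: energy_eq cross_eq algebra_simps sum.distrib)

lemma sum_mean_noise: "(\<Sum>i<n. \<theta> i * x i) = cross x - signal"
proof -
  have "cross x = (\<Sum>i<n. \<theta> i * (\<mu> i + x i))"
    unfolding cross_def obs_def \<theta>_def by (rule sum_proj_proj)
  then show ?thesis
    by (simp add: signal_eq algebra_simps sum.distrib)
qed

lemma energy_le_total: "energy x \<le> total x"
proof -
  let ?y = "\<lambda>i. \<mu> i + x i"
  have "0 \<le> (\<Sum>i<n. (?y i - obs x i)\<^sup>2)"
    by (simp add: sum_nonneg)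
  also have "\<dots> = (\<Sum>i<n. (?y i)\<^sup>2) - 2 * (\<Sum>i<n. obs x i * ?y i) + (\<Sum>i<n. (obs x i)\<^sup>2)"
    by (simp add: power2_diff sum.distrib sum_subtractf sum_distrib_left algebra_simps)
  also have "\<dots> = total x - energy x"
    using energy_eq[of x] by (simp add: total_def energy_def)
  finally show ?thesis
    by simp
qed

lemma measurable_obs [measurable]: "(\<lambda>x. obs x i) \<in> borel_measurable Q"
  unfolding obs_def proj_def by (auto intro!: borel_measurable_sum)

lemma measurable_energy [measurable]: "energy \<in> borel_measurable Q"
  unfolding energy_def by measurable

lemma measurable_cross [measurable]: "cross \<in> borel_measurable Q"
  unfolding cross_def by measurable

text \<open>Stated for the square because |p q| \<le> (p^2 + q^2) / 2 then bounds a product of two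
  such functions linearly in \<open>total\<close>, which is the bound
  \<open>integrable_noise_bound\<close> accepts.\<close>

definition linear_growth :: "((nat \<Rightarrow> real) \<Rightarrow> real) \<Rightarrow> bool" where
  "linear_growth p \<longleftrightarrow> (\<exists>K. \<forall>x. (p x)\<^sup>2 \<le> K * (1 + total x))"

lemma linear_growth_const: "linear_growth (\<lambda>_. c)"
  unfolding linear_growth_def
  by (rule exI[of _ "c\<^sup>2"]) (auto simp: total_nonneg algebra_simps intro!: mult_nonneg_nonneg)

lemma linear_growth_add:
  assumes "linear_growth p" "linear_growth q"
  shows "linear_growth (\<lambda>x. p x + q x)"
proof -
  obtain K L where K: "(p x)\<^sup>2 \<le> K * (1 + total x)" and L: "(q x)\<^sup>2 \<le> L * (1 + total x)" for x
    using assms unfolding linear_growth_def by blast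
  have "(p x + q x)\<^sup>2 \<le> (2 * K + 2 * L) * (1 + total x)" for x
  proof -
    have "(p x + q x)\<^sup>2 \<le> 2 * (p x)\<^sup>2 + 2 * (q x)\<^sup>2"
      using zero_le_power2[of "p x - q x"] by (simp add: power2_eq_square algebra_simps)
    with K[of x] L[of x] show ?thesis
      unfolding distrib_right by linarith
  qed
  then show ?thesis
    unfolding linear_growth_def by blast
qed

lemma linear_growth_cmult:
  assumes "linear_growth p"
  shows "linear_growth (\<lambda>x. c * p x)"
proof -
  obtain K where K: "(p x)\<^sup>2 \<le> K * (1 + total x)" for x
    using assms unfolding linear_growth_def by blast
  have "(c * p x)\<^sup>2 \<le> c\<^sup>2 * K * (1 + total x)" for x
    using mult_left_mono[OF K[of x], of "c\<^sup>2"] by (simp add: power_mult_distrib mult.assoc)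
  then show ?thesis
    unfolding linear_growth_def by blast
qed

lemma linear_growth_obs: "linear_growth (\<lambda>x. obs x i)" if "i < n"
  unfolding linear_growth_def
proof (intro exI[of _ 1] allI)
  fix x
  have "(obs x i)\<^sup>2 \<le> energy x"
    unfolding energy_def using that by (intro member_le_sum) auto
  also have "\<dots> \<le> total x"
    by (rule energy_le_total)
  finally show "(obs x i)\<^sup>2 \<le> 1 * (1 + total x)"
    by simp
qed

lemma linear_growth_component: "linear_growth (\<lambda>x. x i)" if "i < n"
proof -
  have "linear_growth (\<lambda>x. \<mu> i + x i)"
    unfolding linear_growth_def
  proof (intro exI[of _ 1] allI)
    fix x
    have "(\<mu> i + x i)\<^sup>2 \<le> total x"
      unfolding total_def using that by (intro member_le_sum) auto
    then show "(\<mu> i + x i)\<^sup>2 \<le> 1 * (1 + total x)"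
      by simp
  qed
  from linear_growth_add[OF this linear_growth_const[of "- \<mu> i"]] show ?thesis
    by simp
qed

text \<open>Every term in Stein's identity has this shape: two factors that are affine in the noise,
  times a function of the energy.\<close>

lemma integrable_growth:
  assumes \<tau>: "0 \<le> \<tau>" "\<tau> < 1 / (2 * \<sigma>\<^sup>2)"
    and p: "linear_growth p" "p \<in> borel_measurable Q"
    and q: "linear_growth q" "q \<in> borel_measurable Q"
    and f: "f \<in> borel_measurable borel" "\<And>s. s \<ge> 0 \<Longrightarrow> \<bar>f s\<bar> \<le> C * exp (\<tau> * s)"
  shows "integrable Q (\<lambda>x. p x * q x * f (energy x))"
proof -
  obtain K L where K: "(p x)\<^sup>2 \<le> K * (1 + total x)" and L: "(q x)\<^sup>2 \<le> L * (1 + total x)" for x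
    using p(1) q(1) unfolding linear_growth_def by blast
  have C: "C \<ge> 0"
    using f(2)[of 0] by simp
  have "\<bar>p x * q x * f (energy x)\<bar> \<le> (K + L) / 2 * C * (1 + total x) * exp (\<tau> * total x)" for x
  proof -
    have "2 * \<bar>p x * q x\<bar> \<le> (p x)\<^sup>2 + (q x)\<^sup>2"
      using sum_squares_bound[of "\<bar>p x\<bar>" "\<bar>q x\<bar>"] by (simp add: abs_mult)
    also have "\<dots> \<le> (K + L) * (1 + total x)"
      using K[of x] L[of x] by (simp add: algebra_simps)
    finally have pq: "\<bar>p x * q x\<bar> \<le> (K + L) / 2 * (1 + total x)"
      by simp
    have "\<bar>f (energy x)\<bar> \<le> C * exp (\<tau> * energy x)"
      by (rule f(2)[OF energy_nonneg])
    also have "\<dots> \<le> C * exp (\<tau> * total x)"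
      using C \<tau> energy_le_total[of x] by (intro mult_left_mono) (auto intro: mult_left_mono)
    finally have "\<bar>p x * q x\<bar> * \<bar>f (energy x)\<bar> \<le> ((K + L) / 2 * (1 + total x)) * (C * exp (\<tau> * total x))"
      using pq by (intro mult_mono) (auto intro: order_trans[OF abs_ge_zero])
    then show ?thesis
      by (simp add: abs_mult mult_ac)
  qed
  moreover have "(\<lambda>x. p x * q x * f (energy x)) \<in> borel_measurable Q"
    using p(2) q(2) f(1) by measurable
  ultimately show ?thesis
    by (intro integrable_noise_bound[OF sigma_pos \<tau>(2), of _ n "(K + L) / 2 * C" \<mu>])
      (simp_all add: total_def)
qed

lemma integrable_energy_growth:
  assumes \<tau>: "0 \<le> \<tau>" "\<tau> < 1 / (2 * \<sigma>\<^sup>2)"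
    and f: "f \<in> borel_measurable borel" "\<And>s. s \<ge> 0 \<Longrightarrow> \<bar>f s\<bar> \<le> C * exp (\<tau> * s)"
  shows "integrable Q (\<lambda>x. f (energy x))"
    and "integrable Q (\<lambda>x. energy x * f (energy x))"
    and "integrable Q (\<lambda>x. cross x * f (energy x))"
proof -
  note int = integrable_growth[OF \<tau> _ _ _ _ f]
  show "integrable Q (\<lambda>x. f (energy x))"
    using int[OF linear_growth_const[of 1] _ linear_growth_const[of 1]] by simp
  have "integrable Q (\<lambda>x. \<Sum>i<n. obs x i * obs x i * f (energy x))"
    by (intro Bochner_Integration.integrable_sum int linear_growth_obs) auto
  then show "integrable Q (\<lambda>x. energy x * f (energy x))"
    by (simp add: energy_def power2_eq_square sum_distrib_right)
  have "integrable Q (\<lambda>x. \<Sum>i<n. \<theta> i * obs x i * f (energy x))"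
    by (intro Bochner_Integration.integrable_sum int linear_growth_obs linear_growth_const) auto
  then show "integrable Q (\<lambda>x. cross x * f (energy x))"
    by (simp add: cross_def sum_distrib_right)
qed

section \<open>Dependence of a block on a single noise coordinate\<close>

lemma D_column_sq: "(\<Sum>j<n. (D j i)\<^sup>2) = D i i" if "i < n"
proof -
  have "(\<Sum>j<n. (D j i)\<^sup>2) = (\<Sum>j<n. D i j * D j i)"
  proof (intro sum.cong refl)
    fix j assume "j \<in> {..<n}"
    then show "(D j i)\<^sup>2 = D i j * D j i"
      using sym[OF that, of j] by (simp add: power2_eq_square)
  qed
  then show ?thesis
    by (simp add: idem[OF that that])
qed

text \<open>The diagonal entry is the squared length of its column, so a zero on the diagonal
  removes coordinate \<open>i\<close> from the block altogether.\<close>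

lemma column_zero:
  assumes "i < n" "D i i = 0"
  shows "proj v i = 0"
proof -
  have "\<forall>j\<in>{..<n}. (D j i)\<^sup>2 = 0"
    using D_column_sq[OF assms(1)] assms(2) by (subst sum_nonneg_eq_0_iff[symmetric]) auto
  then show ?thesis
    unfolding proj_def by (intro sum.neutral ballI) (metis assms(1) lessThan_iff mult_zero_left sym zero_eq_power2)
qed

lemma obs_update:
  assumes "i < n"
  shows "obs (x(i := r)) j = obs (x(i := 0)) j + D j i * r"
proof -
  have "D j k * (\<mu> k + (x(i := r)) k) = D j k * (\<mu> k + (x(i := 0)) k) + (if k = i then D j i * r else 0)" for k
    by (auto simp: algebra_simps)
  then show ?thesis
    using assms unfolding obs_def proj_def by (simp add: sum.distrib)
qed

text \<open>The polynomial form, with leading coefficient \<open>D i i\<close>, turns finiteness of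
  the level sets of the energy along a coordinate line into a count of roots.\<close>

lemma energy_update:
  assumes "i < n"
  shows "energy (x(i := r)) = poly [:energy (x(i := 0)), 2 * obs (x(i := 0)) i, D i i:] r"
proof -
  let ?\<alpha> = "obs (x(i := 0))"
  have "(\<Sum>j<n. D j i * ?\<alpha> j) = proj ?\<alpha> i"
    unfolding proj_def by (intro sum.cong refl) (metis assms lessThan_iff sym)
  also have "\<dots> = ?\<alpha> i"
    using assms unfolding obs_def by (rule proj_proj)
  finally have *: "(\<Sum>j<n. D j i * ?\<alpha> j) = ?\<alpha> i" .
  have "energy (x(i := r)) = (\<Sum>j<n. (?\<alpha> j)\<^sup>2 + 2 * r * (D j i * ?\<alpha> j) + r\<^sup>2 * (D j i)\<^sup>2)"
    unfolding energy_def obs_update[OF assms, of x r]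
    by (intro sum.cong refl) (simp add: power2_eq_square algebra_simps)
  also have "\<dots> = energy (x(i := 0)) + 2 * r * (\<Sum>j<n. D j i * ?\<alpha> j) + r\<^sup>2 * (\<Sum>j<n. (D j i)\<^sup>2)"
    by (simp add: energy_def sum.distrib sum_distrib_left)
  finally show ?thesis
    unfolding * D_column_sq[OF assms] by (simp add: power2_eq_square algebra_simps)
qed

lemma energy_has_derivative:
  assumes "i < n"
  shows "((\<lambda>r. energy (x(i := r))) has_real_derivative 2 * obs (x(i := r)) i) (at r)"
proof -
  have "((\<lambda>r. poly [:energy (x(i := 0)), 2 * obs (x(i := 0)) i, D i i:] r)
      has_real_derivative 2 * obs (x(i := r)) i) (at r)"
    by (subst obs_update[OF assms, of x r])
      (auto intro!: derivative_eq_intros simp: pderiv_pCons algebra_simps)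
  then show ?thesis
    by (simp only: energy_update[OF assms, symmetric])
qed

lemma obs_has_derivative:
  assumes "i < n"
  shows "((\<lambda>r. obs (x(i := r)) j) has_real_derivative D j i) (at r)"
proof -
  have "((\<lambda>r. obs (x(i := 0)) j + D j i * r) has_real_derivative D j i) (at r)"
    by (auto intro!: derivative_eq_intros)
  then show ?thesis
    by (simp only: obs_update[OF assms, symmetric])
qed

text \<open>This is the sum over i of the coordinate identity for the vector field (obs + c
  \<theta>) \<psi>(energy). Its divergence is tr \<psi> + 2 (energy + c cross) \<psi>', since the
  gradient of the energy is 2 obs.\<close>

lemma stein_identity_projection:
  assumes \<tau>: "0 \<le> \<tau>" "\<tau> < 1 / (2 * \<sigma>\<^sup>2)"
    and cont: "continuous_on UNIV \<psi>" and fin: "finite E"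
    and deriv: "\<And>s. s \<notin> E \<Longrightarrow> (\<psi> has_real_derivative \<psi>' s) (at s)"
    and meas: "\<psi>' \<in> borel_measurable borel"
    and bound: "\<And>s. s \<ge> 0 \<Longrightarrow> \<bar>\<psi> s\<bar> \<le> C * exp (\<tau> * s)"
    and bound': "\<And>s. s \<ge> 0 \<Longrightarrow> \<bar>\<psi>' s\<bar> \<le> C' * exp (\<tau> * s)"
  shows "(\<integral>x. (energy x - (1 - c) * cross x - c * signal) * \<psi> (energy x) \<partial>Q) =
    \<sigma>\<^sup>2 * (\<integral>x. tr * \<psi> (energy x) + 2 * (energy x + c * cross x) * \<psi>' (energy x) \<partial>Q)"
proof -
  have [measurable]: "\<psi> \<in> borel_measurable borel"
    using cont by (rule borel_measurable_continuous_onI)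
  note meas [measurable]
  note int = integrable_growth[OF \<tau> _ _ _ _ _ bound] and int' = integrable_growth[OF \<tau> _ _ _ _ _ bound']
  define f where "f i x = obs x i + c * \<theta> i" for i x
  define F where "F i x = f i x * \<psi> (energy x)" for i x
  define G where "G i x = D i i * \<psi> (energy x) + f i x * (2 * obs x i) * \<psi>' (energy x)" for i x
  have f_meas [measurable]: "f i \<in> borel_measurable Q" for i
    unfolding f_def by measurable
  have f_growth: "linear_growth (f i)" if "i < n" for i
    unfolding f_def using that by (intro linear_growth_add linear_growth_obs linear_growth_const)
  have F_int: "integrable Q (F i)" if "i < n" for i
    using int[OF f_growth[OF that] _ linear_growth_const[of 1]] by (simp add: F_def[abs_def])
  have xF_int: "integrable Q (\<lambda>x. x i * F i x)" if "i < n" for i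
    using int[OF linear_growth_component[OF that] _ f_growth[OF that]] that
    by (simp add: F_def mult_ac)
  have G_int: "integrable Q (G i)" if "i < n" for i
    unfolding G_def
    using int[OF linear_growth_const[of "D i i"] _ linear_growth_const[of 1]] that
    by (intro Bochner_Integration.integrable_add int' f_growth linear_growth_cmult linear_growth_obs) auto
  have stein: "(\<integral>x. x i * F i x \<partial>Q) = \<sigma>\<^sup>2 * (\<integral>x. G i x \<partial>Q)" if i: "i < n" for i
  proof (rule stein_identity_coordinate[OF sigma_pos i F_int[OF i] xF_int[OF i] G_int[OF i]])
    fix x :: "nat \<Rightarrow> real"
    let ?z = "\<lambda>r. x(i := r)"
    have en_cont: "continuous_on UNIV (\<lambda>r. energy (?z r))"
      by (intro continuous_at_imp_continuous_on ballI DERIV_isCont[OF energy_has_derivative[OF i]])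
    have "continuous_on UNIV (\<lambda>r. \<psi> (energy (?z r)))"
      using continuous_on_compose2[OF cont en_cont] by simp
    moreover have "continuous_on UNIV (\<lambda>r. obs (?z r) i)"
      by (intro continuous_at_imp_continuous_on ballI DERIV_isCont[OF obs_has_derivative[OF i]])
    ultimately show "continuous_on UNIV (\<lambda>r. F i (?z r))"
      unfolding F_def f_def by (intro continuous_intros)
    show "\<exists>A. finite A \<and> (\<forall>r. r \<notin> A \<longrightarrow>
        ((\<lambda>r. F i (?z r)) has_real_derivative G i (?z r)) (at r))"
    \<comment> \<open>If \<open>D i i = 0\<close>, the energy is constant in this coordinate, so
      that a level set may be the whole line; but then \<open>F i\<close> and \<open>G i\<close>
      vanish. Otherwise the energy is a genuine quadratic and meets each point of \<open>E\<close>
      finitely often.\<close>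
    proof (cases "D i i = 0")
      case True
      then have "f i y = 0" for y
        by (simp add: f_def obs_def \<theta>_def column_zero[OF i])
      with True show ?thesis
        by (intro exI[of _ "{}"]) (simp add: F_def G_def)
    next
      case False
      let ?A = "\<Union>e\<in>E. {r. energy (?z r) = e}"
      have "finite {r. energy (?z r) = e}" for e
      proof -
        have "{r. energy (?z r) = e} =
            {r. poly [:energy (x(i := 0)) - e, 2 * obs (x(i := 0)) i, D i i:] r = 0}"
          by (rule Collect_cong, subst energy_update[OF i]) (simp add: algebra_simps)
        also have "finite \<dots>"
          by (rule poly_roots_finite) (use False in simp)
        finally show ?thesis .
      qed
      then have "finite ?A"
        using fin by auto
      moreover have "((\<lambda>r. F i (?z r)) has_real_derivative G i (?z r)) (at r)" if r: "r \<notin> ?A" for r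
      proof -
        have "energy (?z r) \<notin> E"
          using r by auto
        from DERIV_chain2[OF deriv[OF this] energy_has_derivative[OF i, of x r]]
        have 1: "((\<lambda>r. \<psi> (energy (?z r))) has_real_derivative
            \<psi>' (energy (?z r)) * (2 * obs (?z r) i)) (at r)" .
        have 2: "((\<lambda>r. f i (?z r)) has_real_derivative D i i) (at r)"
          unfolding f_def by (auto intro!: derivative_eq_intros obs_has_derivative[OF i])
        show ?thesis
          using DERIV_mult[OF 2 1] unfolding F_def G_def by (simp add: mult_ac)
      qed
      ultimately show ?thesis
        by blast
    qed
  qed
  have sum_G: "(\<Sum>i<n. G i x) = tr * \<psi> (energy x) + 2 * (energy x + c * cross x) * \<psi>' (energy x)" for x
  proof -
    have "(\<Sum>i<n. G i x) = (\<Sum>i<n. D i i) * \<psi> (energy x) +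
        2 * ((\<Sum>i<n. (obs x i)\<^sup>2) + c * (\<Sum>i<n. \<theta> i * obs x i)) * \<psi>' (energy x)"
      unfolding G_def f_def sum_distrib_left sum_distrib_right sum.distrib[symmetric]
      by (intro sum.cong refl) (simp add: power2_eq_square algebra_simps)
    then show ?thesis
      by (simp add: tr_def energy_def cross_def)
  qed
  have sum_F: "(\<Sum>i<n. x i * F i x) = (energy x - (1 - c) * cross x - c * signal) * \<psi> (energy x)" for x
  proof -
    have "(\<Sum>i<n. x i * F i x) = ((\<Sum>i<n. obs x i * x i) + c * (\<Sum>i<n. \<theta> i * x i)) * \<psi> (energy x)"
      unfolding F_def f_def sum_distrib_left sum_distrib_right sum.distrib[symmetric]
      by (intro sum.cong refl) (simp add: algebra_simps)
    then show ?thesis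
      unfolding sum_obs_noise sum_mean_noise by (simp add: algebra_simps)
  qed
  have "(\<integral>x. (\<Sum>i<n. x i * F i x) \<partial>Q) = (\<Sum>i<n. \<integral>x. x i * F i x \<partial>Q)"
    using xF_int by (intro Bochner_Integration.integral_sum) auto
  also have "\<dots> = \<sigma>\<^sup>2 * (\<Sum>i<n. \<integral>x. G i x \<partial>Q)"
    by (simp add: stein sum_distrib_left)
  also have "(\<Sum>i<n. \<integral>x. G i x \<partial>Q) = (\<integral>x. (\<Sum>i<n. G i x) \<partial>Q)"
    using G_int by (intro Bochner_Integration.integral_sum[symmetric]) auto
  finally show ?thesis
    unfolding sum_F sum_G .
qed

lemma integrable_energy: "integrable Q energy"
  and integrable_cross: "integrable Q cross"
  and integral_energy: "(\<integral>x. energy x \<partial>Q) = signal + tr * \<sigma>\<^sup>2"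
  and integral_cross: "(\<integral>x. cross x \<partial>Q) = signal"
proof -
  interpret prob_space Q
    by (rule prob_space_Q)
  have \<tau>: "(0::real) \<le> 0" "0 < 1 / (2 * \<sigma>\<^sup>2)"
    using sigma_pos by auto
  show ie: "integrable Q energy" and ic: "integrable Q cross"
    using integrable_energy_growth(2,3)[OF \<tau>, of "\<lambda>_. 1" 1] by simp_all
  \<comment> \<open>With \<psi> = 1, the choice c = 1 isolates the mean of \<open>energy\<close>,
    and c = 0 then yields that of \<open>cross\<close>.\<close>
  have stein: "(\<integral>x. energy x - (1 - c) * cross x - c * signal \<partial>Q) = tr * \<sigma>\<^sup>2" for c
    using stein_identity_projection[OF \<tau>, of "\<lambda>_. 1" "{}" "\<lambda>_. 0" 1 0 c] by (simp add: prob_space)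
  show "(\<integral>x. energy x \<partial>Q) = signal + tr * \<sigma>\<^sup>2"
    using stein[of 1] ie by (simp add: prob_space)
  then show "(\<integral>x. cross x \<partial>Q) = signal"
    using stein[of 0] ie ic by simp
qed

lemma scaled_loss_eq:
  "(\<Sum>i<n. (\<gamma> * obs x i - \<theta> i)\<^sup>2) = \<gamma>\<^sup>2 * energy x - 2 * \<gamma> * cross x + signal"
  unfolding energy_def cross_def signal_def
  by (simp add: sum_distrib_left sum_subtractf[symmetric] sum.distrib[symmetric] power2_eq_square algebra_simps)

lemma linear_shrinkage_risk:
  shows "integrable Q (\<lambda>x. \<Sum>i<n. (\<gamma> * obs x i - \<theta> i)\<^sup>2)"
    and "(\<integral>x. (\<Sum>i<n. (\<gamma> * obs x i - \<theta> i)\<^sup>2) \<partial>Q) = (1 - \<gamma>)\<^sup>2 * signal + \<gamma>\<^sup>2 * (tr * \<sigma>\<^sup>2)"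
proof -
  interpret prob_space Q
    by (rule prob_space_Q)
  show "integrable Q (\<lambda>x. \<Sum>i<n. (\<gamma> * obs x i - \<theta> i)\<^sup>2)"
    unfolding scaled_loss_eq using integrable_energy integrable_cross by simp
  show "(\<integral>x. (\<Sum>i<n. (\<gamma> * obs x i - \<theta> i)\<^sup>2) \<partial>Q) = (1 - \<gamma>)\<^sup>2 * signal + \<gamma>\<^sup>2 * (tr * \<sigma>\<^sup>2)"
    unfolding scaled_loss_eq using integrable_energy integrable_cross
    by (simp add: integral_energy integral_cross prob_space power2_eq_square algebra_simps)
qed

section \<open>The moment generating function of the energy\<close>

definition mgf :: "real \<Rightarrow> real" where
  "mgf t = (\<integral>x. exp (t * energy x) \<partial>Q)"

lemma integrable_exp_energy:
  assumes "t < 1 / (2 * \<sigma>\<^sup>2)"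
  shows "integrable Q (\<lambda>x. exp (t * energy x))"
    and "integrable Q (\<lambda>x. energy x * exp (t * energy x))"
    and "integrable Q (\<lambda>x. cross x * exp (t * energy x))"
proof -
  define \<tau> where "\<tau> = max t 0"
  have \<tau>: "0 \<le> \<tau>" "\<tau> < 1 / (2 * \<sigma>\<^sup>2)"
    using assms sigma_pos by (auto simp: \<tau>_def)
  have b: "\<bar>exp (t * s)\<bar> \<le> 1 * exp (\<tau> * s)" if "s \<ge> 0" for s
    using that by (auto simp: \<tau>_def intro!: mult_right_mono)
  note int = integrable_energy_growth[OF \<tau>, of "\<lambda>s. exp (t * s)" 1, OF _ b]
  show "integrable Q (\<lambda>x. exp (t * energy x))"
    "integrable Q (\<lambda>x. energy x * exp (t * energy x))"
    "integrable Q (\<lambda>x. cross x * exp (t * energy x))"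
    using int by simp_all
qed

lemma mgf_has_derivative:
  assumes t: "t < 1 / (2 * \<sigma>\<^sup>2)"
  shows "(mgf has_real_derivative (\<integral>x. energy x * exp (t * energy x) \<partial>Q)) (at t)"
proof -
  \<comment> \<open>The exponent t' leaves room below the critical value: energy * exp (t' * energy)
    is still integrable and dominates every difference quotient whose increment keeps t + h below
    t'.\<close>
  obtain t' where t': "t < t'" "t' < 1 / (2 * \<sigma>\<^sup>2)"
    using dense[OF t] by blast
  let ?q = "\<lambda>h x. (exp ((t + h) * energy x) - exp (t * energy x)) / h"
  have "((\<lambda>h. (mgf (t + h) - mgf t) / h) \<longlongrightarrow> (\<integral>x. energy x * exp (t * energy x) \<partial>Q)) (at 0)"
    unfolding tendsto_at_iff_sequentially comp_def
  proof (intro allI impI)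
    fix Y :: "nat \<Rightarrow> real" assume Y: "\<forall>i. Y i \<in> UNIV - {0}" "Y \<longlonglongrightarrow> 0"
    have "eventually (\<lambda>k. Y k < t' - t) sequentially"
      using order_tendstoD(2)[OF Y(2), of "t' - t"] t' by simp
    then obtain k0 where k0: "\<And>k. k \<ge> k0 \<Longrightarrow> Y k < t' - t"
      by (auto simp: eventually_sequentially)
    define Z where "Z k = Y (k + k0)" for k
    have Z: "Z k \<noteq> 0" "t + Z k < t'" for k
      using Y(1) k0[of "k + k0"] by (auto simp: Z_def)
    have "(\<lambda>k. \<integral>x. ?q (Z k) x \<partial>Q) \<longlonglongrightarrow> (\<integral>x. energy x * exp (t * energy x) \<partial>Q)"
    proof (rule integral_dominated_convergence[where w = "\<lambda>x. energy x * exp (t' * energy x)"])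
      show "integrable Q (\<lambda>x. energy x * exp (t' * energy x))"
        by (rule integrable_exp_energy(2)[OF t'(2)])
      show "AE x in Q. (\<lambda>k. ?q (Z k) x) \<longlonglongrightarrow> energy x * exp (t * energy x)"
      proof (rule AE_I2)
        fix x
        have "((\<lambda>t. exp (t * energy x)) has_real_derivative energy x * exp (t * energy x)) (at t)"
          by (auto intro!: derivative_eq_intros)
        then have "((\<lambda>h. ?q h x) \<longlongrightarrow> energy x * exp (t * energy x)) (at 0)"
          by (simp add: DERIV_def)
        moreover have "Z \<longlonglongrightarrow> 0"
          unfolding Z_def by (rule LIMSEQ_ignore_initial_segment[OF Y(2)])
        ultimately show "(\<lambda>k. ?q (Z k) x) \<longlonglongrightarrow> energy x * exp (t * energy x)"
          using Z(1) unfolding tendsto_at_iff_sequentially comp_def by blast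
      qed
      show "AE x in Q. norm (?q (Z k) x) \<le> energy x * exp (t' * energy x)" for k
      proof (rule AE_I2)
        fix x
        have e: "energy x \<ge> 0"
          by (rule energy_nonneg)
        \<comment> \<open>The tangent of exp at b lies below exp at a. This bounds the difference
          quotient for increments of either sign.\<close>
        have diff: "exp b - exp a \<le> (b - a) * exp b" for a b :: real
          using exp_ge_add_one_self[of "a - b"] mult_right_mono[of "1 + (a - b)" "exp (a - b)" "exp b"]
          by (simp add: exp_diff algebra_simps)
        show "norm (?q (Z k) x) \<le> energy x * exp (t' * energy x)"
        proof (cases "Z k > 0")
          case True
          have "exp ((t + Z k) * energy x) - exp (t * energy x)
              \<le> Z k * energy x * exp ((t + Z k) * energy x)"
            using diff[of "(t + Z k) * energy x" "t * energy x"] by (simp add: algebra_simps)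
          also have "\<dots> \<le> Z k * energy x * exp (t' * energy x)"
            using True e Z(2)[of k] by (intro mult_left_mono) (auto intro: mult_right_mono)
          finally have "?q (Z k) x \<le> energy x * exp (t' * energy x)"
            using True by (simp add: field_simps)
          moreover have "?q (Z k) x \<ge> 0"
            using True e by (simp add: mult_right_mono)
          ultimately show ?thesis
            by simp
        next
          case False
          then have neg: "Z k < 0"
            using Z(1)[of k] by simp
          have "exp (t * energy x) - exp ((t + Z k) * energy x)
              \<le> - Z k * energy x * exp (t * energy x)"
            using diff[of "t * energy x" "(t + Z k) * energy x"] by (simp add: algebra_simps)
          also have "\<dots> \<le> - Z k * energy x * exp (t' * energy x)"
            using neg e t'(1) by (intro mult_left_mono) (auto intro: mult_right_mono mult_nonpos_nonneg)
          finally have "?q (Z k) x \<le> energy x * exp (t' * energy x)"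
            using neg by (simp add: field_simps)
          moreover have "?q (Z k) x \<ge> 0"
            using neg e by (intro divide_nonpos_neg) (auto intro: mult_right_mono)
          ultimately show ?thesis
            by simp
        qed
      qed
    qed measurable
    moreover have "(\<integral>x. ?q (Z k) x \<partial>Q) = (mgf (t + Z k) - mgf t) / Z k" for k
    proof -
      have "t + Z k < 1 / (2 * \<sigma>\<^sup>2)"
        using Z(2)[of k] t'(2) by simp
      then show ?thesis
        unfolding mgf_def using integrable_exp_energy(1) t by simp
    qed
    ultimately have "(\<lambda>k. (mgf (t + Z k) - mgf t) / Z k) \<longlonglongrightarrow> (\<integral>x. energy x * exp (t * energy x) \<partial>Q)"
      by (simp only:)
    then show "(\<lambda>k. (mgf (t + Y k) - mgf t) / Y k) \<longlonglongrightarrow> (\<integral>x. energy x * exp (t * energy x) \<partial>Q)"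
      unfolding Z_def by (rule LIMSEQ_offset)
  qed
  then show ?thesis
    by (simp add: DERIV_def)
qed

text \<open>
  This value of \<open>c\<close> makes the terms with \<open>cross\<close> cancel in Stein's identity for
  \<open>\<psi> s = exp (t s)\<close>.
\<close>
lemma mgf_derivative_eq:
  assumes t: "0 \<le> t" "t < 1 / (2 * \<sigma>\<^sup>2)"
  defines "c \<equiv> 1 / (1 - 2 * \<sigma>\<^sup>2 * t)"
  shows "(\<integral>x. energy x * exp (t * energy x) \<partial>Q) = (c\<^sup>2 * signal + c * \<sigma>\<^sup>2 * tr) * mgf t"
proof -
  have pos: "1 - 2 * \<sigma>\<^sup>2 * t > 0"
    using t sigma_pos by (simp add: field_simps)
  note int = integrable_exp_energy[OF t(2)]
  let ?I = "\<integral>x. energy x * exp (t * energy x) \<partial>Q" and ?J = "\<integral>x. cross x * exp (t * energy x) \<partial>Q"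
  have "(\<integral>x. (energy x - (1 - c) * cross x - c * signal) * exp (t * energy x) \<partial>Q) =
    \<sigma>\<^sup>2 * (\<integral>x. tr * exp (t * energy x) + 2 * (energy x + c * cross x) * (t * exp (t * energy x)) \<partial>Q)"
    by (rule stein_identity_projection[OF t, where E = "{}" and C = 1 and C' = t])
      (auto intro!: continuous_intros derivative_eq_intros simp: abs_mult t)
  moreover have "(\<integral>x. (energy x - (1 - c) * cross x - c * signal) * exp (t * energy x) \<partial>Q)
      = ?I - (1 - c) * ?J - c * signal * mgf t"
    using int by (simp add: left_diff_distrib mult.assoc mgf_def)
  moreover have "(\<integral>x. tr * exp (t * energy x) + 2 * (energy x + c * cross x) * (t * exp (t * energy x)) \<partial>Q)
      = tr * mgf t + 2 * t * ?I + 2 * t * c * ?J"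
  proof -
    have "tr * exp (t * energy x) + 2 * (energy x + c * cross x) * (t * exp (t * energy x)) =
        tr * exp (t * energy x) + 2 * t * (energy x * exp (t * energy x))
          + 2 * t * c * (cross x * exp (t * energy x))" for x
      by (simp add: algebra_simps)
    with int show ?thesis
      by (simp add: mgf_def)
  qed
  ultimately have "?I - (1 - c) * ?J - c * signal * mgf t
      = \<sigma>\<^sup>2 * (tr * mgf t + 2 * t * ?I + 2 * t * c * ?J)"
    by simp
  then have "(1 - 2 * \<sigma>\<^sup>2 * t) * ?I - (c * signal + \<sigma>\<^sup>2 * tr) * mgf t
      = ((1 - c) + \<sigma>\<^sup>2 * (2 * t * c)) * ?J"
    by (simp add: algebra_simps)
  moreover have "(1 - c) + \<sigma>\<^sup>2 * (2 * t * c) = 0"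
    using pos by (simp add: c_def field_simps)
  ultimately have "(1 - 2 * \<sigma>\<^sup>2 * t) * ?I = (c * signal + \<sigma>\<^sup>2 * tr) * mgf t"
    by simp
  note * = this
  have "c * (1 - 2 * \<sigma>\<^sup>2 * t) = 1"
    using pos by (simp add: c_def)
  then have "?I = c * ((1 - 2 * \<sigma>\<^sup>2 * t) * ?I)"
    by (simp only: mult.assoc[symmetric] mult_1)
  also have "\<dots> = (c\<^sup>2 * signal + c * \<sigma>\<^sup>2 * tr) * mgf t"
    unfolding * by (simp add: power2_eq_square algebra_simps)
  finally show ?thesis .
qed

text \<open>In closed form the logarithm is - tr log (1 - 2 u) / 2 plus the same signal term, and u
  + u^2 / (1 - 2 u) is a rational upper bound for - log (1 - 2 u) / 2. The closed form is bypassed: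
  with \<open>G\<close> the claimed exponent, mgf * exp (- G) has a nonpositive derivative by
  \<open>mgf_derivative_eq\<close>.\<close>

lemma mgf_le:
  assumes tr: "tr \<ge> 0" and t: "0 \<le> t" "t < 1 / (2 * \<sigma>\<^sup>2)"
  defines "u \<equiv> \<sigma>\<^sup>2 * t"
  shows "mgf t \<le> exp (tr * (u + u\<^sup>2 / (1 - 2 * u)) + signal / \<sigma>\<^sup>2 * (u / (1 - 2 * u)))"
proof -
  interpret prob_space Q
    by (rule prob_space_Q)
  define G where "G s = tr * (\<sigma>\<^sup>2 * s + (\<sigma>\<^sup>2 * s)\<^sup>2 / (1 - 2 * (\<sigma>\<^sup>2 * s)))
    + signal / \<sigma>\<^sup>2 * (\<sigma>\<^sup>2 * s / (1 - 2 * (\<sigma>\<^sup>2 * s)))" for s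
  have "mgf t * exp (- G t) \<le> mgf 0 * exp (- G 0)"
  proof (rule DERIV_nonpos_imp_nonincreasing[OF t(1)])
    fix s assume s: "0 \<le> s" "s \<le> t"
    then have s': "s < 1 / (2 * \<sigma>\<^sup>2)"
      using t by simp
    define r where "r = \<sigma>\<^sup>2 * s"
    have r: "0 \<le> r" "1 - 2 * r > 0"
      using s s' sigma_pos by (simp_all add: r_def field_simps)
    define c where "c = 1 / (1 - 2 * r)"
    have c: "c * (1 - 2 * r) = 1" "c > 0"
      using r by (simp_all add: c_def)
    define g where "g = tr * (\<sigma>\<^sup>2 + 2 * \<sigma>\<^sup>2 * (r - r\<^sup>2) * c\<^sup>2) + signal * c\<^sup>2"
    have dG: "(G has_real_derivative g) (at s)"
    proof -
      have nz: "1 - 2 * r \<noteq> 0"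
        using r by simp
      have "((\<lambda>r. r / (1 - 2 * r)) has_real_derivative
          (1 * (1 - 2 * r) - r * (- 2)) / ((1 - 2 * r) * (1 - 2 * r))) (at r)"
        using nz by (auto intro!: derivative_eq_intros)
      then have k': "((\<lambda>r. r / (1 - 2 * r)) has_real_derivative c\<^sup>2) (at r)"
        by (simp add: c_def power2_eq_square)
      have "((\<lambda>r. r + r * (r / (1 - 2 * r))) has_real_derivative 1 + (1 * (r / (1 - 2 * r)) + c\<^sup>2 * r)) (at r)"
        by (intro DERIV_add DERIV_mult k' DERIV_ident)
      moreover have "r / (1 - 2 * r) = r * c\<^sup>2 * (1 - 2 * r)"
        using nz by (simp add: c_def power2_eq_square)
      then have "1 + (1 * (r / (1 - 2 * r)) + c\<^sup>2 * r) = 1 + 2 * (r - r\<^sup>2) * c\<^sup>2"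
        by (simp add: power2_eq_square algebra_simps)
      ultimately have "((\<lambda>r. r + r * (r / (1 - 2 * r))) has_real_derivative 1 + 2 * (r - r\<^sup>2) * c\<^sup>2) (at r)"
        by (simp only:)
      then have h: "((\<lambda>r. r + r\<^sup>2 / (1 - 2 * r)) has_real_derivative 1 + 2 * (r - r\<^sup>2) * c\<^sup>2) (at (\<sigma>\<^sup>2 * s))"
        by (simp add: power2_eq_square r_def)
      note k = k'[unfolded r_def]
      have l: "((\<lambda>s. \<sigma>\<^sup>2 * s) has_real_derivative \<sigma>\<^sup>2) (at s)"
        by (auto intro!: derivative_eq_intros)
      show ?thesis
        unfolding G_def
        by (rule DERIV_cong[OF DERIV_add[OF DERIV_cmult[OF DERIV_chain2[OF h l]]
              DERIV_cmult[OF DERIV_chain2[OF k l]]]])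
          (use sigma_pos in \<open>simp add: g_def field_simps\<close>)
    qed
    let ?I = "\<integral>x. energy x * exp (s * energy x) \<partial>Q"
    have "?I = (c\<^sup>2 * signal + c * \<sigma>\<^sup>2 * tr) * mgf s"
      using mgf_derivative_eq[OF s(1) s'] by (simp add: c_def r_def mult.assoc)
    moreover have "c\<^sup>2 * signal + c * \<sigma>\<^sup>2 * tr \<le> g"
    proof -
      \<comment> \<open>A polynomial identity: c (1 - 2 r) = 1 removes the last product and leaves c
        + 2 (r c)^2. The square is the slack of the rational bound; the signal parts of the two
        derivatives agree exactly.\<close>
      have "1 + 2 * (r - r\<^sup>2) * c\<^sup>2 - c = 2 * (r * c)\<^sup>2 + (1 - c * (1 - 2 * r)) * (1 - 2 * r * c)"
        by (simp add: power2_eq_square algebra_simps)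
      then have "1 + 2 * (r - r\<^sup>2) * c\<^sup>2 = c + 2 * (r * c)\<^sup>2"
        unfolding c(1) by simp
      then have "c \<le> 1 + 2 * (r - r\<^sup>2) * c\<^sup>2"
        by simp
      then have "\<sigma>\<^sup>2 * tr * c \<le> \<sigma>\<^sup>2 * tr * (1 + 2 * (r - r\<^sup>2) * c\<^sup>2)"
        using tr by (intro mult_left_mono) auto
      then show ?thesis
        by (simp add: g_def algebra_simps)
    qed
    moreover have "mgf s \<ge> 0"
      unfolding mgf_def by (rule Bochner_Integration.integral_nonneg) simp
    ultimately have "?I \<le> g * mgf s"
      by (simp add: mult_right_mono)
    then have "(?I - g * mgf s) * exp (- G s) \<le> 0"
      by (intro mult_nonpos_nonneg) auto
    moreover have "((\<lambda>t. mgf t * exp (- G t)) has_real_derivative (?I - g * mgf s) * exp (- G s)) (at s)"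
      using mgf_has_derivative[OF s'] dG
      by (auto intro!: derivative_eq_intros simp: algebra_simps)
    ultimately show "\<exists>y. ((\<lambda>t. mgf t * exp (- G t)) has_real_derivative y) (at s) \<and> y \<le> 0"
      by blast
  qed
  also have "mgf 0 * exp (- G 0) = 1"
    by (simp add: mgf_def G_def prob_space)
  finally have "mgf t \<le> exp (G t)"
    by (simp add: exp_minus field_simps)
  then show ?thesis
    by (simp add: G_def u_def)
qed

end

section \<open>The risk of one block\<close>

text \<open>
  The exponent of Chernoff's bound at \<open>t = u / \<sigma>\<^sup>2\<close>.  With this choice of \<open>u\<close> it equals
  \<open>- d \<phi>\<^sup>2 / (16 + 24 \<phi>)\<close> when \<open>A' = \<phi> d / 2\<close>.
\<close>
lemma penalty_exponent_le:
  fixes d \<phi> A' :: real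
  assumes \<phi>: "0 < \<phi>" and d: "d > 0" and A': "A' \<le> \<phi> * d / 2"
  defines "u \<equiv> \<phi> / (4 + 6 * \<phi>)"
  shows "- u * (d * (1 + \<phi>)) + (d * (u + u\<^sup>2 / (1 - 2 * u)) + A' * (u / (1 - 2 * u)))
    \<le> - (d * \<phi>\<^sup>2 / (16 * (1 + 2 * sqrt \<phi>)\<^sup>2))"
proof -
  \<comment> \<open>For small \<phi> the exponent is about d (u^2 - u \<phi> / 2), which is minimal
    at u = \<phi> / 4 with value - d \<phi>^2 / 16. The correction 6 \<phi> in the denominator of
    \<open>u\<close> makes q = \<phi> / (4 + 4 \<phi>).\<close>
  define q where "q = u / (1 - 2 * u)"
  have p: "4 + 6 * \<phi> > 0" "1 + \<phi> > 0"
    using \<phi> by simp_all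
  have "1 - 2 * u = (4 + 4 * \<phi>) / (4 + 6 * \<phi>)"
    using p by (simp add: u_def field_simps)
  then have q: "q = \<phi> / (4 + 4 * \<phi>)"
    using p by (simp add: q_def u_def)
  then have "q \<ge> 0"
    using \<phi> by simp
  then have "A' * q \<le> \<phi> * d / 2 * q"
    by (intro mult_right_mono A')
  then have "- u * (d * (1 + \<phi>)) + (d * (u + u * q) + A' * q)
      \<le> d * (- (u * \<phi>) + u * q + \<phi> * q / 2)"
    by (simp add: algebra_simps)
  also have "- (u * \<phi>) + u * q + \<phi> * q / 2 = - (\<phi>\<^sup>2 / (16 + 24 * \<phi>))"
  proof -
    have "u * q + \<phi> * q / 2 = q * (u + \<phi> / 2)"
      by (simp add: algebra_simps)
    also have "u + \<phi> / 2 = (4 + 4 * \<phi>) * (3 / 4 * u)"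
    proof -
      have "u * (4 + 6 * \<phi>) = \<phi>"
        using p by (simp add: u_def)
      then show ?thesis
        by (simp add: algebra_simps)
    qed
    also have "q * \<dots> = (q * (4 + 4 * \<phi>)) * (3 / 4 * u)"
      by (simp only: mult.assoc)
    also have "q * (4 + 4 * \<phi>) = \<phi>"
      using p by (simp add: q)
    also have "\<phi> * (3 / 4 * u) = 3 / 4 * (\<phi> * u)"
      by simp
    finally have "- (u * \<phi>) + u * q + \<phi> * q / 2 = - (\<phi> * u / 4)"
      using mult.commute[of u \<phi>] by linarith
    also have "\<phi> * u / 4 = \<phi>\<^sup>2 / (16 + 24 * \<phi>)"
      using p by (simp add: u_def power2_eq_square field_simps)
    finally show ?thesis .
  qed
  \<comment> \<open>Expanding the square gives 16 + 64 sqrt \<phi> + 64 \<phi>, which exceeds 16 +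
    24 \<phi>.\<close>
  also have "d * - (\<phi>\<^sup>2 / (16 + 24 * \<phi>)) \<le> - (d * \<phi>\<^sup>2 / (16 * (1 + 2 * sqrt \<phi>)\<^sup>2))"
  proof -
    have "(sqrt \<phi>)\<^sup>2 = \<phi>" "sqrt \<phi> \<ge> 0"
      using \<phi> by simp_all
    then have "16 + 24 * \<phi> \<le> 16 * (1 + 2 * sqrt \<phi>)\<^sup>2"
      using \<phi> by (simp add: power2_sum power_mult_distrib)
    then have "\<phi>\<^sup>2 / (16 * (1 + 2 * sqrt \<phi>)\<^sup>2) \<le> \<phi>\<^sup>2 / (16 + 24 * \<phi>)"
      using p \<phi> by (intro divide_left_mono) (auto intro!: mult_pos_pos add_pos_nonneg)
    then have "d * (\<phi>\<^sup>2 / (16 * (1 + 2 * sqrt \<phi>)\<^sup>2)) \<le> d * (\<phi>\<^sup>2 / (16 + 24 * \<phi>))"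
      using d by (intro mult_left_mono) auto
    then show ?thesis
      by simp
  qed
  finally show ?thesis
    by (simp add: q_def power2_eq_square)
qed

context noisy_projection
begin

text \<open>By \<open>small\<close> the mean signal + v of the energy, v = tr \<sigma>^2, is at most
  v (1 + \<phi> / 2), so half of the penalty separates it from the threshold. This gap gives
  Chernoff's bound its negative exponent.\<close>

lemma energy_tail_bound:
  assumes \<phi>: "0 < \<phi>" and tr: "tr > 0" and small: "signal \<le> \<phi> * (tr * \<sigma>\<^sup>2) / 2"
  shows "(\<integral>x. indicator {s. s > tr * \<sigma>\<^sup>2 * (1 + \<phi>)} (energy x) \<partial>Q)
    \<le> exp (- (tr * \<phi>\<^sup>2 / (16 * (1 + 2 * sqrt \<phi>)\<^sup>2)))" (is "?P \<le> _")
proof -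
  interpret prob_space Q
    by (rule prob_space_Q)
  define u where "u = \<phi> / (4 + 6 * \<phi>)"
  define t where "t = u / \<sigma>\<^sup>2"
  let ?a = "tr * \<sigma>\<^sup>2 * (1 + \<phi>)"
  have s2: "\<sigma>\<^sup>2 > 0"
    using sigma_pos by simp
  have u: "0 \<le> u" "u < 1 / 2"
    using \<phi> by (simp_all add: u_def field_simps)
  have t: "0 \<le> t" "t < 1 / (2 * \<sigma>\<^sup>2)" "\<sigma>\<^sup>2 * t = u" "t * ?a = u * (tr * (1 + \<phi>))"
    using u s2 by (simp_all add: t_def field_simps)
  note int = integrable_exp_energy(1)[OF t(2)]
  have "?P \<le> (\<integral>x. exp (- t * ?a) * exp (t * energy x) \<partial>Q)"
  proof (rule integral_mono)
    show "integrable Q (\<lambda>x. indicat_real {s. s > ?a} (energy x))"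
      by (rule integrable_const_bound[where B = 1]) (auto split: split_indicator)
    show "integrable Q (\<lambda>x. exp (- t * ?a) * exp (t * energy x))"
      using int by simp
    show "indicator {s. s > ?a} (energy x) \<le> exp (- t * ?a) * exp (t * energy x)" for x
      using t(1) mult_left_mono[of ?a "energy x" t]
      by (auto simp: exp_add[symmetric] split: split_indicator)
  qed
  also have "\<dots> = exp (- t * ?a) * mgf t"
    by (simp add: mgf_def)
  also have "\<dots> \<le> exp (- t * ?a) * exp (tr * (u + u\<^sup>2 / (1 - 2 * u)) + signal / \<sigma>\<^sup>2 * (u / (1 - 2 * u)))"
    using mgf_le[OF _ t(1,2)] tr by (intro mult_left_mono) (simp_all add: t(3))
  also have "\<dots> = exp (- u * (tr * (1 + \<phi>)) + (tr * (u + u\<^sup>2 / (1 - 2 * u)) + signal / \<sigma>\<^sup>2 * (u / (1 - 2 * u))))"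
    using t(4) by (simp add: exp_add[symmetric])
  also have "\<dots> \<le> exp (- (tr * \<phi>\<^sup>2 / (16 * (1 + 2 * sqrt \<phi>)\<^sup>2)))"
    unfolding u_def exp_le_cancel_iff
    by (rule penalty_exponent_le[OF \<phi> tr]) (use small s2 in \<open>simp add: field_simps\<close>)
  finally show ?thesis .
qed

text \<open>Stein's unbiased risk estimate for the factor 1 - \<psi>, where \<psi> = min 1 (a / S).
  Expanding the loss leaves one product that is not already a function of \<open>energy\<close> or
  of known mean, namely (energy - cross) \<psi>, and Stein's identity with c = 0 evaluates
  it.\<close>

lemma stein_loss_unbiased:
  assumes a: "a > 0"
  defines "\<psi> \<equiv> \<lambda>s. if s \<le> a then 1 else a / s"
    and "U \<equiv> \<lambda>s. if s \<le> a then s - 2 * \<sigma>\<^sup>2 * tr else (a\<^sup>2 - 2 * \<sigma>\<^sup>2 * a * (tr - 2)) / s"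
    and "L \<equiv> \<lambda>x. \<Sum>i<n. (max (1 - a / energy x) 0 * obs x i - \<theta> i)\<^sup>2"
  shows "integrable Q L"
    and "integrable Q (\<lambda>x. U (energy x))"
    and "(\<integral>x. L x \<partial>Q) = tr * \<sigma>\<^sup>2 + (\<integral>x. U (energy x) \<partial>Q)"
proof -
  interpret prob_space Q
    by (rule prob_space_Q)
  define \<psi>' where "\<psi>' s = (if s \<le> a then 0 else - a / s\<^sup>2)" for s
  have \<tau>: "(0::real) \<le> 0" "0 < 1 / (2 * \<sigma>\<^sup>2)"
    using sigma_pos by auto
  have \<psi>_meas [measurable]: "\<psi> \<in> borel_measurable borel" and \<psi>'_meas [measurable]: "\<psi>' \<in> borel_measurable borel"
    unfolding \<psi>_def \<psi>'_def by measurable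
  have \<psi>_bound: "0 \<le> \<psi> s" "\<psi> s \<le> 1" for s
    using a by (auto simp: \<psi>_def)
  have sq_bound: "s * (\<psi> s)\<^sup>2 \<le> a" if "s \<ge> 0" for s
    using that a by (auto simp: \<psi>_def power2_eq_square field_simps)
  have \<psi>'_bound: "\<bar>\<psi>' s\<bar> \<le> 1 / a" for s
  proof (cases "s \<le> a")
    case False
    then have "a * a \<le> s\<^sup>2"
      using a unfolding power2_eq_square by (intro mult_mono) auto
    with False a show ?thesis
      by (simp add: \<psi>'_def divide_simps)
  qed (use a in \<open>simp add: \<psi>'_def\<close>)
  have cont: "continuous_on UNIV \<psi>"
  proof -
    have "continuous_on ({..a} \<union> {a..}) \<psi>"
      unfolding \<psi>_def using a
      by (intro continuous_on_cases continuous_intros) auto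
    moreover have "{..a} \<union> {a..} = UNIV"
      by auto
    ultimately show ?thesis
      by simp
  qed
  have deriv: "(\<psi> has_real_derivative \<psi>' s) (at s)" if s: "s \<notin> {a}" for s
  proof (cases "s < a")
    case True
    then have "eventually (\<lambda>r. r \<in> {..<a}) (nhds s)"
      by (intro eventually_nhds_in_open) auto
    then have "eventually (\<lambda>r. 1 = \<psi> r) (nhds s)"
      by eventually_elim (simp add: \<psi>_def)
    from DERIV_cong_ev[OF refl this refl, of "0::real"] True show ?thesis
      by (simp add: \<psi>'_def)
  next
    case False
    with s have gt: "s > a"
      by auto
    have "eventually (\<lambda>r. r \<in> {a<..}) (nhds s)"
      using gt by (intro eventually_nhds_in_open) auto
    then have "eventually (\<lambda>r. a / r = \<psi> r) (nhds s)"
      by eventually_elim (simp add: \<psi>_def)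
    moreover have "((\<lambda>r. a / r) has_real_derivative - a / s\<^sup>2) (at s)"
      using gt a by (auto intro!: derivative_eq_intros simp: power2_eq_square)
    ultimately show ?thesis
      using gt DERIV_cong_ev[of s s "\<lambda>r. a / r" \<psi>] by (simp add: \<psi>'_def)
  qed
  have b1: "\<bar>\<psi> s\<bar> \<le> 1 * exp (0 * s)" and b2: "\<bar>\<psi>' s\<bar> \<le> 1 / a * exp (0 * s)" for s
    using \<psi>_bound[of s] \<psi>'_bound[of s] by auto
  note i\<psi> = integrable_energy_growth[OF \<tau> \<psi>_meas b1] and i\<psi>' = integrable_energy_growth[OF \<tau> \<psi>'_meas b2]
  have stein: "(\<integral>x. (energy x - cross x) * \<psi> (energy x) \<partial>Q)
      = \<sigma>\<^sup>2 * (\<integral>x. tr * \<psi> (energy x) + 2 * energy x * \<psi>' (energy x) \<partial>Q)"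
    using stein_identity_projection[where E = "{a}" and c = 0, OF \<tau> cont _ deriv \<psi>'_meas b1 b2] by simp
  have i2: "integrable Q (\<lambda>x. energy x * (\<psi> (energy x))\<^sup>2)"
    by (rule integrable_const_bound[where B = a])
      (auto simp: energy_nonneg abs_mult intro!: sq_bound)
  \<comment> \<open>At energy 0 the division yields the factor 1 while 1 - \<psi> is 0; both sides
    still agree because every component of the block is 0.\<close>
  have shrink: "max (1 - a / energy x) 0 * obs x i = (1 - \<psi> (energy x)) * obs x i" if "i < n" for x i
  proof (cases "energy x = 0")
    case True
    then have "\<forall>j\<in>{..<n}. (obs x j)\<^sup>2 = 0"
      unfolding energy_def by (subst sum_nonneg_eq_0_iff[symmetric]) auto
    with that show ?thesis
      by simp
  next
    case False
    then have "energy x > 0"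
      using energy_nonneg[of x] by simp
    with a show ?thesis
      by (auto simp: \<psi>_def max_def field_simps)
  qed
  have L_eq: "L x = energy x - 2 * cross x + signal + energy x * (\<psi> (energy x))\<^sup>2
      - 2 * ((energy x - cross x) * \<psi> (energy x))" for x
  proof -
    have "L x = (\<Sum>i<n. ((1 - \<psi> (energy x)) * obs x i - \<theta> i)\<^sup>2)"
      unfolding L_def by (intro sum.cong refl) (simp add: shrink)
    then show ?thesis
      unfolding scaled_loss_eq by (simp add: power2_eq_square algebra_simps)
  qed
  have ic: "integrable Q (\<lambda>x. (energy x - cross x) * \<psi> (energy x))"
    using i\<psi> by (simp add: left_diff_distrib)
  have id: "integrable Q (\<lambda>x. tr * \<psi> (energy x) + 2 * energy x * \<psi>' (energy x))"
    using i\<psi> i\<psi>' by (simp add: mult.assoc)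
  show "integrable Q L"
    unfolding L_eq[abs_def] using integrable_energy integrable_cross i2 ic by simp
  have U_eq: "U (energy x) = energy x * (\<psi> (energy x))\<^sup>2
      - 2 * \<sigma>\<^sup>2 * (tr * \<psi> (energy x) + 2 * energy x * \<psi>' (energy x))" for x
    using a by (auto simp: U_def \<psi>_def \<psi>'_def power2_eq_square field_simps)
  show "integrable Q (\<lambda>x. U (energy x))"
    unfolding U_eq using i2 id by simp
  have "(\<integral>x. L x \<partial>Q) = signal + tr * \<sigma>\<^sup>2 - 2 * signal + signal
      + (\<integral>x. energy x * (\<psi> (energy x))\<^sup>2 \<partial>Q) - 2 * (\<integral>x. (energy x - cross x) * \<psi> (energy x) \<partial>Q)"
    unfolding L_eq using integrable_energy integrable_cross i2 ic
    by (simp add: integral_energy integral_cross prob_space)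
  also have "\<dots> = tr * \<sigma>\<^sup>2 + (\<integral>x. U (energy x) \<partial>Q)"
    unfolding stein U_eq using i2 id by simp
  finally show "(\<integral>x. L x \<partial>Q) = tr * \<sigma>\<^sup>2 + (\<integral>x. U (energy x) \<partial>Q)" .
qed

end

text \<open>Here \<alpha> / (1 + \<alpha>) is the oracle risk in units of the noise variance. The
  assumption \<alpha> \<ge> \<phi> / 2 turns \<phi>^2 into at most 2 \<phi> \<alpha> and 8 / d into
  at most 16 \<alpha> / (d \<phi>): these are the two terms of the relative error.\<close>

lemma shrinkage_risk_bound:
  fixes d \<phi> \<alpha> :: real
  assumes \<phi>: "0 < \<phi>" "\<phi> < 1" and d: "d > 0" and \<alpha>: "\<phi> / 2 \<le> \<alpha>"
  shows "\<alpha> \<le> \<phi> \<Longrightarrow> \<alpha> + 4 / d \<le> (1 + (2 * \<phi> + 16 / (d * \<phi>))) * (\<alpha> / (1 + \<alpha>))" (is "_ \<Longrightarrow> ?A")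
    and "1 - (1 + \<phi>) * (1 - \<phi> - 4 / d) / (1 + \<alpha>) \<le> (1 + (2 * \<phi> + 16 / (d * \<phi>))) * (\<alpha> / (1 + \<alpha>))" (is ?B)
proof -
  have \<alpha>0: "\<alpha> > 0"
    using \<alpha> \<phi> by simp
  have step: "8 / d \<le> 16 * \<alpha> / (d * \<phi>)"
    using mult_left_mono[OF \<alpha>, of "16 / (d * \<phi>)"] d \<phi> by simp
  show ?A if le: "\<alpha> \<le> \<phi>"
  proof -
    have "(\<alpha> + 4 / d) * (1 + \<alpha>) = \<alpha> + \<alpha> * \<alpha> + 4 / d * (1 + \<alpha>)"
      by (simp add: algebra_simps)
    also have "\<dots> \<le> \<alpha> + \<alpha> * \<phi> + 4 / d * 2"
      using le \<phi> \<alpha>0 d by (intro add_mono mult_left_mono) auto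
    also have "\<dots> \<le> \<alpha> + \<alpha> * (2 * \<phi>) + 16 * \<alpha> / (d * \<phi>)"
      using step \<alpha>0 \<phi> by (intro add_mono) auto
    also have "\<dots> = (1 + (2 * \<phi> + 16 / (d * \<phi>))) * \<alpha>"
      by (simp add: algebra_simps)
    finally show ?thesis
      using \<alpha>0 by (simp add: pos_le_divide_eq)
  qed
  have "1 + \<alpha> - (1 + \<phi>) * (1 - \<phi> - 4 / d) = \<alpha> + \<phi> * \<phi> + 4 / d * (1 + \<phi>)"
    by (simp add: algebra_simps)
  also have "\<dots> \<le> \<alpha> + \<phi> * (2 * \<alpha>) + 4 / d * 2"
    using \<alpha> \<phi> d by (intro add_mono mult_left_mono) auto
  also have "\<dots> \<le> \<alpha> + \<phi> * (2 * \<alpha>) + 16 * \<alpha> / (d * \<phi>)"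
    using step by simp
  also have "\<dots> = (1 + (2 * \<phi> + 16 / (d * \<phi>))) * \<alpha>"
    by (simp add: algebra_simps)
  finally have "(1 + \<alpha> - (1 + \<phi>) * (1 - \<phi> - 4 / d)) / (1 + \<alpha>) \<le> (1 + (2 * \<phi> + 16 / (d * \<phi>))) * \<alpha> / (1 + \<alpha>)"
    using \<alpha>0 by (intro divide_right_mono) auto
  then show ?B
    using \<alpha>0 by (simp add: diff_divide_distrib)
qed

text \<open>The left side is the tangent at t of the convex function 1 / s.\<close>

lemma inverse_tangent_le:
  fixes s t :: real
  assumes "s > 0" "t > 0"
  shows "2 / t - s / t\<^sup>2 \<le> 1 / s"
proof -
  have "0 \<le> (s - t)\<^sup>2 / (s * t\<^sup>2)"
    using assms by simp
  also have "\<dots> = 1 / s - (2 / t - s / t\<^sup>2)"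
    using assms by (simp add: power2_eq_square field_simps)
  finally show ?thesis
    by simp
qed

text \<open>
  In units of the noise variance \<open>v\<close> of the block, \<open>W\<close> equals \<open>s - 1\<close> for \<open>s \<le> 1 + \<phi>\<close> and equals
  \<open>1 - \<kappa> / s\<close> beyond, with an upward jump of \<open>4 / d\<close>.  Its concave majorant is \<open>s - 1 + 4 / d\<close> up to
  \<open>1 + \<phi>\<close>, and the next two lemmas are the tangents at which Jensen's inequality is applied.
\<close>
lemma loss_majorant_linear:
  fixes d \<phi> s :: real
  assumes \<phi>: "0 < \<phi>" "\<phi> < 1" and d: "d > 0" "4 / d \<le> 1 - \<phi>" and s: "1 + \<phi> \<le> s"
  shows "1 - (1 + \<phi>) * (1 - \<phi> - 4 / d) / s \<le> s - 1 + 4 / d"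
proof -
  define k where "k = 1 - \<phi> - 4 / d"
  have k: "0 \<le> k" "k \<le> 1" "k \<le> 1 + \<phi>"
    unfolding k_def using d(2) \<phi> divide_nonneg_pos[of 4 d, OF _ d(1)] by linarith+
  \<comment> \<open>The difference of the two sides is a monic quadratic in s with roots 1 + \<phi>
    and k, so it is nonnegative beyond the larger root. At 1 + \<phi> the majorant touches the upper
    end of the jump.\<close>
  have "(2 - 4 / d - s) * s \<le> (1 + \<phi>) * k"
  proof -
    have "2 - 4 / d - s = 1 + \<phi> + k - s"
      by (simp add: k_def)
    then have "(1 + \<phi>) * k - (2 - 4 / d - s) * s = (s - (1 + \<phi>)) * (s - k)"
      by (simp only:) (simp add: algebra_simps)
    also have "\<dots> \<ge> 0"
      using s k by (intro mult_nonneg_nonneg) auto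
    finally show ?thesis
      by simp
  qed
  then have "2 - 4 / d - s \<le> (1 + \<phi>) * k / s"
    using s \<phi> by (simp add: pos_le_divide_eq)
  then show ?thesis
    by (simp add: k_def)
qed

lemma loss_majorant_tangent:
  fixes d \<phi> s t :: real
  assumes \<phi>: "0 < \<phi>" "\<phi> < 1" and d: "d > 0" "4 / d \<le> 1 - \<phi>" and t: "1 + \<phi> \<le> t"
  defines "\<kappa> \<equiv> (1 + \<phi>) * (1 - \<phi> - 4 / d)"
  shows "s \<le> 1 + \<phi> \<Longrightarrow> s - 1 \<le> 1 - 2 * \<kappa> / t + \<kappa> / t\<^sup>2 * s"
    and "s > 1 + \<phi> \<Longrightarrow> 1 - \<kappa> / s \<le> 1 - 2 * \<kappa> / t + \<kappa> / t\<^sup>2 * s"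
proof -
  \<comment> \<open>Nonnegativity is where 4 / d \<le> 1 - \<phi> enters: it makes 1 - \<kappa> / s
    concave, so that its tangents lie above it.\<close>
  have \<kappa>: "0 \<le> \<kappa>" "\<kappa> \<le> 1"
  proof -
    show "0 \<le> \<kappa>"
      unfolding \<kappa>_def using \<phi> d by (intro mult_nonneg_nonneg) auto
    have "\<kappa> \<le> (1 + \<phi>) * (1 - \<phi>)"
      unfolding \<kappa>_def using \<phi> d by (intro mult_left_mono) auto
    also have "\<dots> \<le> 1"
      using \<phi> by (simp add: algebra_simps)
    finally show "\<kappa> \<le> 1" .
  qed
  have tangent: "1 - \<kappa> / s \<le> 1 - 2 * \<kappa> / t + \<kappa> / t\<^sup>2 * s" if "s > 0" for s
    using mult_left_mono[OF inverse_tangent_le[OF that, of t] \<kappa>(1)] t \<phi> by (simp add: algebra_simps)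
  then show "s > 1 + \<phi> \<Longrightarrow> 1 - \<kappa> / s \<le> 1 - 2 * \<kappa> / t + \<kappa> / t\<^sup>2 * s"
    using \<phi> by simp
  assume s: "s \<le> 1 + \<phi>"
  \<comment> \<open>Left of 1 + \<phi> the tangent is flatter than s - 1, so comparing the two at 1
    + \<phi> suffices. There s - 1 has the value \<phi>, the curve 1 - \<kappa> / s the value \<phi>
    + 4 / d, and the tangent lies above the curve.\<close>
  have "1 \<le> t\<^sup>2"
    using t \<phi> by (intro one_le_power) auto
  then have "\<kappa> / t\<^sup>2 \<le> 1"
    using \<kappa> by (simp add: divide_le_eq_1)
  then have "\<kappa> / t\<^sup>2 * (1 + \<phi> - s) \<le> 1 * (1 + \<phi> - s)"
    using s by (intro mult_right_mono) auto
  then have "s - 1 \<le> \<phi> - \<kappa> / t\<^sup>2 * (1 + \<phi>) + \<kappa> / t\<^sup>2 * s"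
    unfolding right_diff_distrib mult_1 by linarith
  moreover have "\<phi> \<le> 1 - \<kappa> / (1 + \<phi>)"
    using \<phi> d by (simp add: \<kappa>_def)
  moreover have "1 - \<kappa> / (1 + \<phi>) \<le> 1 - 2 * \<kappa> / t + \<kappa> / t\<^sup>2 * (1 + \<phi>)"
    using \<phi> by (intro tangent) simp
  ultimately show "s - 1 \<le> 1 - 2 * \<kappa> / t + \<kappa> / t\<^sup>2 * s"
    by linarith
qed

context noisy_projection
begin

text \<open>Three ranges of \<alpha> = signal / v. Below \<phi> / 2 the jump of the risk function is
  weighted by its small probability; between \<phi> / 2 and \<phi> it is paid in full; above \<phi>
  the mean of energy / v lies past the jump and a tangent applies. Only the first range needs the
  exponential term.\<close>

lemma stein_block_risk:
  assumes \<phi>: "0 < \<phi>" "\<phi> < 1" and tr: "tr > 0" and large: "1 / tr \<le> (1 - \<phi>) / 4"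
  defines "L \<equiv> \<lambda>x. \<Sum>i<n. (max (1 - tr * \<sigma>\<^sup>2 * (1 + \<phi>) / energy x) 0 * obs x i - \<theta> i)\<^sup>2"
  shows "integrable Q L"
    and "(\<integral>x. L x \<partial>Q) \<le> (1 + (2 * \<phi> + 16 / (tr * \<phi>))) * (tr * \<sigma>\<^sup>2 * signal / (signal + tr * \<sigma>\<^sup>2))
      + 8 * \<sigma>\<^sup>2 * exp (- (tr * \<phi>\<^sup>2 / (16 * (1 + 2 * sqrt \<phi>)\<^sup>2)))" (is "_ \<le> ?B * _ + ?E")
proof -
  interpret prob_space Q
    by (rule prob_space_Q)
  define v where "v = tr * \<sigma>\<^sup>2"
  define \<alpha> where "\<alpha> = signal / v"
  define k where "k = 1 - \<phi> - 4 / tr"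
  define a where "a = v * (1 + \<phi>)"
  define U where "U s = (if s \<le> a then s - 2 * \<sigma>\<^sup>2 * tr else (a\<^sup>2 - 2 * \<sigma>\<^sup>2 * a * (tr - 2)) / s)" for s
  have v: "v > 0"
    using tr sigma_pos by (simp add: v_def)
  have a: "a > 0"
    using v \<phi> by (simp add: a_def)
  have large': "4 / tr \<le> 1 - \<phi>"
    using large by simp
  have signal: "signal = v * \<alpha>"
    using v by (simp add: \<alpha>_def)
  have \<alpha>: "\<alpha> \<ge> 0"
    using v signal_nonneg by (simp add: \<alpha>_def)
  have target: "tr * \<sigma>\<^sup>2 * signal / (signal + tr * \<sigma>\<^sup>2) = v * (\<alpha> / (1 + \<alpha>))"
  proof -
    have "tr * \<sigma>\<^sup>2 * signal / (signal + tr * \<sigma>\<^sup>2) = v * (v * \<alpha>) / (v * (1 + \<alpha>))"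
      by (simp add: signal v_def[symmetric] algebra_simps)
    then show ?thesis
      using v by simp
  qed
  have L_eq: "L = (\<lambda>x. \<Sum>i<n. (max (1 - a / energy x) 0 * obs x i - \<theta> i)\<^sup>2)"
    by (simp add: L_def a_def v_def)
  \<comment> \<open>With a = v (1 + \<phi>) the numerator is v^2 (1 + \<phi>) (\<phi> - 1 + 4 / tr),
    which is nonpositive by \<open>large'\<close>.\<close>
  have U_eq: "U s = (if s \<le> a then s - 2 * v else - (v * (1 + \<phi>) * k * v) / s)" for s
  proof -
    have "a\<^sup>2 - 2 * \<sigma>\<^sup>2 * a * (tr - 2) = - (v * (1 + \<phi>) * k * v)"
      using tr unfolding a_def v_def k_def by (simp add: power2_eq_square field_simps)
    then show ?thesis
      by (simp add: U_def v_def mult_ac)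
  qed
  note loss = stein_loss_unbiased[OF a, folded L_eq U_def]
  show "integrable Q L"
    by (rule loss(1))
  have risk: "(\<integral>x. L x \<partial>Q) = (\<integral>x. v + U (energy x) \<partial>Q)"
    using loss(2,3) by (simp add: prob_space v_def)
  have int: "integrable Q (\<lambda>x. v + U (energy x))"
    using loss(2) by simp
  have ratio: "v + U s = v * (if s / v \<le> 1 + \<phi> then s / v - 1 else 1 - (1 + \<phi>) * k / (s / v))" for s
  proof (cases "s \<le> a")
    case True
    then show ?thesis
      using v by (simp add: U_eq a_def field_simps)
  next
    case False
    then have "s > 0"
      using a by simp
    with False show ?thesis
      using v by (simp add: U_eq a_def field_simps)
  qed
  have E_nonneg: "?E \<ge> 0"
    by simp
  \<comment> \<open>The mean of energy - v is the signal, so after this bound the jump is the only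
    excess over the signal.\<close>
  have linear: "v + U s \<le> s - v + 4 * \<sigma>\<^sup>2 * indicator {s. s > a} s" for s
  proof (cases "s \<le> a")
    case False
    then have s: "s / v > 1 + \<phi>"
      using v by (simp add: a_def field_simps)
    have "v + U s = v * (1 - (1 + \<phi>) * k / (s / v))"
      unfolding ratio using s by simp
    also have "\<dots> \<le> v * (s / v - 1 + 4 / tr)"
      unfolding k_def using loss_majorant_linear[OF \<phi> tr large', of "s / v"] s v
      by (intro mult_left_mono) auto
    also have "\<dots> = s - v + 4 * \<sigma>\<^sup>2"
      using sigma_pos tr by (simp add: v_def field_simps)
    finally show ?thesis
      using False by simp
  qed (simp add: U_eq)
  have linear_risk: "(\<integral>x. L x \<partial>Q) \<le> signal + 4 * \<sigma>\<^sup>2 * (\<integral>x. indicator {s. s > a} (energy x) \<partial>Q)"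
  proof -
    have i: "integrable Q (\<lambda>x. indicat_real {s. s > a} (energy x))"
      by (rule integrable_const_bound[where B = 1]) (auto split: split_indicator)
    have "(\<integral>x. L x \<partial>Q) \<le> (\<integral>x. energy x - v + 4 * \<sigma>\<^sup>2 * indicator {s. s > a} (energy x) \<partial>Q)"
      unfolding risk using integrable_energy i by (intro integral_mono int linear) auto
    also have "\<dots> = signal + 4 * \<sigma>\<^sup>2 * (\<integral>x. indicator {s. s > a} (energy x) \<partial>Q)"
      using integrable_energy i by (simp add: integral_energy prob_space v_def)
    finally show ?thesis .
  qed
  show "(\<integral>x. L x \<partial>Q) \<le> ?B * (tr * \<sigma>\<^sup>2 * signal / (signal + tr * \<sigma>\<^sup>2)) + ?E"
    unfolding target
  proof (cases "\<alpha> < \<phi> / 2")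
    case True
    have "signal \<le> \<phi> * (tr * \<sigma>\<^sup>2) / 2"
      using True v by (simp add: \<alpha>_def v_def[symmetric] field_simps)
    from energy_tail_bound[OF \<phi>(1) tr this]
    have "4 * \<sigma>\<^sup>2 * (\<integral>x. indicator {s. s > a} (energy x) \<partial>Q)
        \<le> 4 * \<sigma>\<^sup>2 * exp (- (tr * \<phi>\<^sup>2 / (16 * (1 + 2 * sqrt \<phi>)\<^sup>2)))"
      by (intro mult_left_mono) (simp_all add: a_def v_def)
    also have "\<dots> \<le> ?E"
      by simp
    finally have 1: "(\<integral>x. L x \<partial>Q) \<le> signal + ?E"
      using linear_risk by linarith
    have "1 + \<alpha> \<le> ?B"
    proof -
      have "16 / (tr * \<phi>) \<ge> 0"
        using tr \<phi> by simp
      with True \<phi> show ?thesis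
        by linarith
    qed
    then have "(1 + \<alpha>) * (v * (\<alpha> / (1 + \<alpha>))) \<le> ?B * (v * (\<alpha> / (1 + \<alpha>)))"
      using v \<alpha> by (intro mult_right_mono) auto
    moreover have "(1 + \<alpha>) * (v * (\<alpha> / (1 + \<alpha>))) = signal"
      using \<alpha> by (simp add: signal)
    ultimately show "(\<integral>x. L x \<partial>Q) \<le> ?B * (v * (\<alpha> / (1 + \<alpha>))) + ?E"
      using 1 by linarith
  next
    case False
    then have half: "\<phi> / 2 \<le> \<alpha>"
      by simp
    have "(\<integral>x. L x \<partial>Q) \<le> v * (?B * (\<alpha> / (1 + \<alpha>)))"
    proof (cases "\<alpha> \<le> \<phi>")
      case True
      \<comment> \<open>The mean 1 + \<alpha> of energy / v still lies on the linear piece s - 1 + 4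
        / d of the majorant, so the probability of the jump may be bounded by 1.\<close>
      have "(\<integral>x. indicat_real {s. s > a} (energy x) \<partial>Q) \<le> (\<integral>x. 1 \<partial>Q)"
        by (intro integral_mono integrable_const_bound[where B = 1]) (auto split: split_indicator)
      then have "(\<integral>x. indicat_real {s. s > a} (energy x) \<partial>Q) \<le> 1"
        by (simp add: prob_space)
      from mult_left_mono[OF this, of "4 * \<sigma>\<^sup>2"]
      have "(\<integral>x. L x \<partial>Q) \<le> signal + 4 * \<sigma>\<^sup>2"
        using linear_risk by simp
      also have "\<dots> = v * (\<alpha> + 4 / tr)"
        using tr by (simp add: signal v_def field_simps)
      also have "\<dots> \<le> v * (?B * (\<alpha> / (1 + \<alpha>)))"
        using v shrinkage_risk_bound(1)[OF \<phi> tr half True] by (intro mult_left_mono) auto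
      finally show ?thesis .
    next
      case False
      let ?\<kappa> = "(1 + \<phi>) * (1 - \<phi> - 4 / tr)" and ?t = "1 + \<alpha>"
      have t: "1 + \<phi> \<le> ?t"
        using False by simp
      \<comment> \<open>Jensen's inequality in the form of a tangent: the point of contact 1 +
        \<alpha> is the mean of energy / v, so the tangent has expectation 1 - \<kappa> / (1 +
        \<alpha>).\<close>
      note tangent = loss_majorant_tangent[OF \<phi> tr large' t]
      have "v + U s \<le> v * (1 - 2 * ?\<kappa> / ?t + ?\<kappa> / ?t\<^sup>2 * (s / v))" for s
        unfolding ratio k_def using v tangent[of "s / v"] by (intro mult_left_mono) auto
      then have "(\<integral>x. L x \<partial>Q) \<le> (\<integral>x. v * (1 - 2 * ?\<kappa> / ?t + ?\<kappa> / ?t\<^sup>2 * (energy x / v)) \<partial>Q)"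
        unfolding risk using integrable_energy by (intro integral_mono int) auto
      also have "\<dots> = v * (1 - 2 * ?\<kappa> / ?t + ?\<kappa> / ?t\<^sup>2 * (v * ?t / v))"
      proof -
        have "(\<integral>x. v * (c + c' * (energy x / v)) \<partial>Q) = v * (c + c' * (v * ?t / v))" for c c'
          using integrable_energy v
          by (simp add: distrib_left integral_energy prob_space signal v_def[symmetric])
            (simp add: field_simps)
        then show ?thesis .
      qed
      also have "\<dots> = v * (1 - ?\<kappa> / ?t)"
        using v \<alpha> by (simp add: power2_eq_square diff_divide_distrib)
      also have "\<dots> \<le> v * (?B * (\<alpha> / (1 + \<alpha>)))"
        using v shrinkage_risk_bound(2)[OF \<phi> tr half] by (intro mult_left_mono) auto
      finally show ?thesis .
    qed
    then show "(\<integral>x. L x \<partial>Q) \<le> ?B * (v * (\<alpha> / (1 + \<alpha>))) + ?E"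
      unfolding mult.left_commute[of v] using E_nonneg by linarith
  qed
qed

end

section \<open>Orthogonal projections onto nested column spans\<close>

text \<open>The property inside the definite description of \<open>orth_proj\<close>, with the
  subspace as a parameter.\<close>

definition is_orth_proj :: "nat \<Rightarrow> real vec set \<Rightarrow> real mat \<Rightarrow> bool" where
  "is_orth_proj n U P \<longleftrightarrow> P \<in> carrier_mat n n \<and>
    (\<forall>v \<in> carrier_vec n. P *\<^sub>v v \<in> U \<and> (\<forall>u \<in> U. u \<bullet> (v - P *\<^sub>v v) = 0))"

lemma real_scalar_prod_self_eq_0:
  fixes v :: "real vec"
  assumes v: "v \<in> carrier_vec n" and "v \<bullet> v = 0"
  shows "v = 0\<^sub>v n"
proof -
  have "(\<Sum>i\<in>{0..<n}. (v $ i)\<^sup>2) = 0"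
    using assms by (simp add: scalar_prod_def power2_eq_square)
  then have "\<forall>i\<in>{0..<n}. (v $ i)\<^sup>2 = 0"
    by (subst sum_nonneg_eq_0_iff[symmetric]) auto
  with v show ?thesis
    by (intro eq_vecI) auto
qed

lemma eq_vec_if_diff_self_0:
  fixes v w :: "real vec"
  assumes v: "v \<in> carrier_vec n" and w: "w \<in> carrier_vec n" and "(v - w) \<bullet> (v - w) = 0"
  shows "v = w"
proof -
  have "v - w = 0\<^sub>v n"
    using assms by (intro real_scalar_prod_self_eq_0) auto
  then have "(v - w) $ i = 0" if "i < n" for i
    using that by simp
  then have "v $ i = w $ i" if "i < n" for i
    using that v w by (metis carrier_vecD eq_iff_diff_eq_0 index_minus_vec(1))
  with v w show ?thesis
    by (intro eq_vecI) auto
qed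

lemma eq_mat_on_vecs:
  fixes A B :: "real mat"
  assumes A: "A \<in> carrier_mat n n" and B: "B \<in> carrier_mat n n"
    and eq: "\<And>v. v \<in> carrier_vec n \<Longrightarrow> A *\<^sub>v v = B *\<^sub>v v"
  shows "A = B"
proof (rule eq_matI)
  fix i j assume "i < dim_row B" "j < dim_col B"
  then have ij: "i < n" "j < n"
    using B by auto
  have "(A *\<^sub>v unit_vec n j) $ i = (B *\<^sub>v unit_vec n j) $ i"
    by (simp add: eq)
  with ij A B show "A $$ (i, j) = B $$ (i, j)"
    by simp
qed (use A B in auto)

lemma (in vec_space) span_diff:
  assumes "W \<subseteq> carrier_vec n" "v \<in> span W" "w \<in> span W"
  shows "v - w \<in> span W"
proof -
  have "w \<in> carrier_vec n" "v \<in> carrier_vec n"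
    using assms span_closed by auto
  then have "v - w = v + (- 1) \<cdot>\<^sub>v w"
    by (intro eq_vecI) auto
  then show ?thesis
    using span_add1[OF assms(1,2) smult_in_span[OF assms(1,3), of "- 1"]] by simp
qed

context
  fixes n :: nat and W :: "real vec set"
  assumes W: "W \<subseteq> carrier_vec n"
begin

interpretation V: vec_space "TYPE(real)" n .

lemma orth_proj_fixes:
  assumes P: "is_orth_proj n (V.span W) P" and w: "w \<in> V.span W"
  shows "P *\<^sub>v w = w"
proof -
  have wc: "w \<in> carrier_vec n"
    using W w V.span_closed by simp
  have Pc: "P \<in> carrier_mat n n" and Pw: "P *\<^sub>v w \<in> V.span W"
    and orth: "\<And>u. u \<in> V.span W \<Longrightarrow> u \<bullet> (w - P *\<^sub>v w) = 0"
    using P wc by (auto simp: is_orth_proj_def)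
  have Pwc: "P *\<^sub>v w \<in> carrier_vec n"
    using Pc wc by simp
  have "w - P *\<^sub>v w \<in> V.span W"
    by (rule V.span_diff[OF W w Pw])
  from orth[OF this] show ?thesis
    using eq_vec_if_diff_self_0[OF wc Pwc] by simp
qed

lemma orth_proj_unique:
  assumes P: "is_orth_proj n (V.span W) P" and P': "is_orth_proj n (V.span W) P'"
  shows "P = P'"
proof (rule eq_mat_on_vecs[of _ n])
  show c: "P \<in> carrier_mat n n" "P' \<in> carrier_mat n n"
    using P P' by (auto simp: is_orth_proj_def)
  fix v :: "real vec" assume v: "v \<in> carrier_vec n"
  let ?w = "P *\<^sub>v v - P' *\<^sub>v v"
  have vc: "P *\<^sub>v v \<in> carrier_vec n" "P' *\<^sub>v v \<in> carrier_vec n"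
    using c v by simp_all
  have w: "?w \<in> V.span W"
    using P P' v by (intro V.span_diff[OF W]) (auto simp: is_orth_proj_def)
  have "?w \<bullet> (v - P *\<^sub>v v) = 0" "?w \<bullet> (v - P' *\<^sub>v v) = 0"
    using P P' v w by (auto simp: is_orth_proj_def)
  then have "?w \<bullet> ?w = 0"
    using v vc by (simp add: scalar_prod_minus_distrib[of _ n])
  then show "P *\<^sub>v v = P' *\<^sub>v v"
    by (rule eq_vec_if_diff_self_0[OF vc])
qed

text \<open>A Gram-Schmidt step: q is the residual of the new vector, and the rank-one term projects
  onto its line. This form keeps symmetry visible and shows that the trace grows by 1.\<close>

lemma orth_proj_insert:
  fixes x q :: "real vec"
  assumes P: "is_orth_proj n (V.span W) P" and x: "x \<in> carrier_vec n" "x \<notin> V.span W"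
  defines "q \<equiv> x - P *\<^sub>v x"
  defines "P' \<equiv> mat n n (\<lambda>(i, j). P $$ (i, j) + q $ i * q $ j / (q \<bullet> q))"
  shows "is_orth_proj n (V.span (insert x W)) P'" and "q \<bullet> q \<noteq> 0" and "q \<in> carrier_vec n"
proof -
  have Pc: "P \<in> carrier_mat n n" and P_in: "\<And>v. v \<in> carrier_vec n \<Longrightarrow> P *\<^sub>v v \<in> V.span W"
    and orth: "\<And>u v. u \<in> V.span W \<Longrightarrow> v \<in> carrier_vec n \<Longrightarrow> u \<bullet> (v - P *\<^sub>v v) = 0"
    using P by (auto simp: is_orth_proj_def)
  have Pvc: "P *\<^sub>v v \<in> carrier_vec n" if "v \<in> carrier_vec n" for v
    using Pc that by simp
  show q: "q \<in> carrier_vec n"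
    using x Pvc by (simp add: q_def)
  have xW: "insert x W \<subseteq> carrier_vec n"
    using W x by simp
  have mono: "V.span W \<subseteq> V.span (insert x W)"
    by (rule V.span_is_monotone) auto
  show qq: "q \<bullet> q \<noteq> 0"
  proof
    assume "q \<bullet> q = 0"
    then have "x = P *\<^sub>v x"
      unfolding q_def by (rule eq_vec_if_diff_self_0[OF x(1) Pvc[OF x(1)]])
    with P_in[OF x(1)] x(2) show False
      by simp
  qed
  have q_in: "q \<in> V.span (insert x W)"
    unfolding q_def using mono P_in[OF x(1)] V.span_mem[OF xW, of x]
    by (intro V.span_diff[OF xW]) auto
  have P'v: "P' *\<^sub>v v = P *\<^sub>v v + ((q \<bullet> v) / (q \<bullet> q)) \<cdot>\<^sub>v q" if v: "v \<in> carrier_vec n" for v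
  proof (rule eq_vecI)
    fix i assume "i < dim_vec (P *\<^sub>v v + ((q \<bullet> v) / (q \<bullet> q)) \<cdot>\<^sub>v q)"
    then have i: "i < n"
      using q by simp
    have "(P' *\<^sub>v v) $ i = (\<Sum>j\<in>{0..<n}. (P $$ (i, j) + q $ i * q $ j / (q \<bullet> q)) * v $ j)"
      using i v by (simp add: P'_def scalar_prod_def)
    also have "\<dots> = (\<Sum>j\<in>{0..<n}. P $$ (i, j) * v $ j) + (\<Sum>j\<in>{0..<n}. q $ j * v $ j) / (q \<bullet> q) * q $ i"
      unfolding sum_divide_distrib sum_distrib_right sum.distrib[symmetric]
      by (intro sum.cong refl) (simp add: algebra_simps)
    also have "(\<Sum>j\<in>{0..<n}. q $ j * v $ j) = q \<bullet> v"
      using v by (simp add: scalar_prod_def)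
    also have "(\<Sum>j\<in>{0..<n}. P $$ (i, j) * v $ j) = (P *\<^sub>v v) $ i"
      using i v Pc by (simp add: scalar_prod_def)
    finally show "(P' *\<^sub>v v) $ i = (P *\<^sub>v v + ((q \<bullet> v) / (q \<bullet> q)) \<cdot>\<^sub>v q) $ i"
      using i q Pvc[OF v] by simp
  qed (use q in \<open>simp add: P'_def\<close>)
  show "is_orth_proj n (V.span (insert x W)) P'"
    unfolding is_orth_proj_def
  proof (intro conjI ballI)
    show "P' \<in> carrier_mat n n"
      by (simp add: P'_def)
    fix v :: "real vec" assume v: "v \<in> carrier_vec n"
    let ?c = "(q \<bullet> v) / (q \<bullet> q)"
    show "P' *\<^sub>v v \<in> V.span (insert x W)"
      unfolding P'v[OF v]
      using V.span_add1[OF xW _ V.smult_in_span[OF xW q_in]] mono P_in[OF v] by auto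
    let ?r = "v - P' *\<^sub>v v"
    have r: "?r = (v - P *\<^sub>v v) - ?c \<cdot>\<^sub>v q"
      unfolding P'v[OF v] using v q Pc by (intro eq_vecI) auto
    have rc: "?r \<in> carrier_vec n"
      unfolding r using v q Pvc[OF v] by simp
    have ur: "u \<bullet> ?r = u \<bullet> (v - P *\<^sub>v v) - ?c * (u \<bullet> q)" if "u \<in> carrier_vec n" for u
      unfolding r using that v q Pvc[OF v] by (simp add: scalar_prod_minus_distrib[of _ n])
    \<comment> \<open>Orthogonality is checked on the generators only; it passes to the span because
      a set and its span have the same orthogonal complement.\<close>
    have "?r \<bullet> y = 0" if "y \<in> insert x W" for y
    proof -
      have split: "x \<bullet> z = q \<bullet> z + (P *\<^sub>v x) \<bullet> z" if "z \<in> carrier_vec n" for z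
        unfolding q_def using x Pvc[OF x(1)] that by (simp add: minus_scalar_prod_distrib[of _ n])
      have qv: "q \<bullet> (v - P *\<^sub>v v) = q \<bullet> v"
      proof -
        have "q \<bullet> (P *\<^sub>v v) = (P *\<^sub>v v) \<bullet> q"
          by (rule comm_scalar_prod[OF q Pvc[OF v]])
        also have "\<dots> = 0"
          unfolding q_def by (rule orth[OF P_in[OF v] x(1)])
        finally show ?thesis
          using v q Pvc[OF v] by (simp add: scalar_prod_minus_distrib[of _ n])
      qed
      have "y \<bullet> ?r = 0"
      proof (cases "y = x")
        case True
        have "x \<bullet> (v - P *\<^sub>v v) = q \<bullet> v"
          using split[of "v - P *\<^sub>v v"] qv orth[OF P_in[OF x(1)] v] v Pvc[OF v] by simp
        moreover have "x \<bullet> q = q \<bullet> q"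
          using split[OF q] orth[OF P_in[OF x(1)] x(1)] by (simp add: q_def)
        ultimately show ?thesis
          using True qq ur[OF x(1)] by simp
      next
        case False
        then have y: "y \<in> W"
          using that by simp
        then have "y \<in> V.span W"
          using V.span_mem[OF W] by simp
        then have "y \<bullet> (v - P *\<^sub>v v) = 0" "y \<bullet> q = 0"
          using orth v x by (auto simp: q_def)
        then show ?thesis
          using ur[of y] y W by auto
      qed
      then show ?thesis
        using comm_scalar_prod[OF rc, of y] that xW by auto
    qed
    then have "?r \<in> V.orthogonal_complement (insert x W)"
      using rc by (simp add: V.orthogonal_complement_def)
    then have "?r \<in> V.orthogonal_complement (V.span (insert x W))"
      using xW by simp
    then have *: "?r \<bullet> u = 0" if "u \<in> V.span (insert x W)" for u
      using that by (simp add: V.orthogonal_complement_def)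
    show "u \<bullet> ?r = 0" if "u \<in> V.span (insert x W)" for u
      using *[OF that] comm_scalar_prod[OF rc, of u] V.span_closed[OF xW that] by simp
  qed
qed

end

text \<open>The rank is the size of a maximal independent subset of the set of columns, so rank p
  leaves no room for repeated columns. A column in the span of its predecessors would make the
  independent set of all columns dependent.\<close>

lemma full_rank_cols:
  fixes X :: "real mat"
  assumes X: "X \<in> carrier_mat n p" and rank: "vec_space.rank n X = p"
  shows "distinct (cols X)"
    and "k < p \<Longrightarrow> col X k \<notin> LinearCombinations.module.span class_ring (module_vec TYPE(real) n) (set (take k (cols X)))"
proof -
  interpret V: vec_space "TYPE(real)" n .
  have colsX: "set (cols X) \<subseteq> carrier_vec n"
    using X cols_dim by blast
  have "\<exists>S. finite S \<and> maximal S (\<lambda>T. T \<subseteq> set (cols X) \<and> V.lin_indpt T) \<and> {} \<subseteq> S"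
    by (rule maximal_exists_superset[of "set (cols X)"]) (auto simp: V.lin_dep_def)
  then obtain S where S: "maximal S (\<lambda>T. T \<subseteq> set (cols X) \<and> V.lin_indpt T)"
    by blast
  then have "S \<subseteq> set (cols X)"
    by (simp add: maximal_def)
  then have "p \<le> card (set (cols X))"
    using V.rank_card_indpt[OF X S] rank card_mono[of "set (cols X)" S] by simp
  moreover have "card (set (cols X)) \<le> p"
    using card_length[of "cols X"] X by simp
  ultimately show dist: "distinct (cols X)"
    using X by (intro card_distinct) simp
  have indpt: "V.lin_indpt (set (cols X))"
    by (rule V.full_rank_lin_indpt[OF X rank dist])
  show "col X k \<notin> V.span (set (take k (cols X)))" if k: "k < p"
  proof
    assume in_span: "col X k \<in> V.span (set (take k (cols X)))"
    have colk: "cols X ! k = col X k" "k < length (cols X)"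
      using k X by auto
    have "col X k \<notin> set (take k (cols X))"
      using distinct_take[OF dist, of "Suc k"] colk by (simp add: take_Suc_conv_app_nth)
    then have "set (take k (cols X)) \<subseteq> set (cols X) - {col X k}"
      using set_take_subset[of k "cols X"] by auto
    with in_span have "col X k \<in> V.span (set (cols X) - {col X k})"
      using V.span_is_monotone by blast
    moreover have "col X k \<in> set (cols X)"
      using colk nth_mem by metis
    ultimately have "V.lin_dep (set (cols X))"
      using V.lindep_span[OF _ finite_set, of "cols X"] colsX by auto
    with indpt show False
      by simp
  qed
qed

text \<open>Symmetry and trace are carried through the Gram-Schmidt induction because the defining
  property of the projection does not display them. The trace later becomes the block
  length.\<close>

lemma orth_proj_exists:
  fixes X :: "real mat"
  assumes X: "X \<in> carrier_mat n p" and rank: "vec_space.rank n X = p" and k: "k \<le> p"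
  shows "\<exists>P. is_orth_proj n (LinearCombinations.module.span class_ring (module_vec TYPE(real) n) (set (take k (cols X)))) P
    \<and> (\<forall>i<n. \<forall>j<n. P $$ (i, j) = P $$ (j, i)) \<and> (\<Sum>i<n. P $$ (i, i)) = real k"
  using k
proof (induction k)
  interpret V: vec_space "TYPE(real)" n .
  case 0
  have "is_orth_proj n (V.span {}) (0\<^sub>m n n)"
  proof -
    have "(0\<^sub>m n n :: real mat) *\<^sub>v v = 0\<^sub>v n" if "v \<in> carrier_vec n" for v
      using that by (intro eq_vecI) auto
    then show ?thesis
      unfolding is_orth_proj_def using V.span_empty by auto
  qed
  then show ?case
    by (intro exI[of _ "0\<^sub>m n n"]) auto
next
  interpret V: vec_space "TYPE(real)" n .
  case (Suc k)
  let ?W = "set (take k (cols X))" and ?x = "col X k"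
  have W: "?W \<subseteq> carrier_vec n"
    using X cols_dim set_take_subset[of k "cols X"] by fastforce
  from Suc obtain P where P: "is_orth_proj n (V.span ?W) P"
    and sym: "\<forall>i<n. \<forall>j<n. P $$ (i, j) = P $$ (j, i)" and tr: "(\<Sum>i<n. P $$ (i, i)) = real k"
    by auto
  have x: "?x \<in> carrier_vec n" "?x \<notin> V.span ?W"
    using X Suc.prems full_rank_cols(2)[OF X rank, of k] by auto
  define q where "q = ?x - P *\<^sub>v ?x"
  define P' where "P' = mat n n (\<lambda>(i, j). P $$ (i, j) + q $ i * q $ j / (q \<bullet> q))"
  note ins = orth_proj_insert[OF W P x, folded q_def, folded P'_def]
  have "set (take (Suc k) (cols X)) = insert ?x ?W"
    using X Suc.prems by (simp add: take_Suc_conv_app_nth)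
  moreover have "\<forall>i<n. \<forall>j<n. P' $$ (i, j) = P' $$ (j, i)"
    using sym by (auto simp: P'_def mult.commute)
  moreover have "(\<Sum>i<n. P' $$ (i, i)) = real (Suc k)"
  proof -
    have "(\<Sum>i<n. q $ i * q $ i) = q \<bullet> q"
      using ins(3) by (simp add: scalar_prod_def atLeast0LessThan)
    then show ?thesis
      using ins(2) tr by (simp add: P'_def sum.distrib sum_divide_distrib[symmetric])
  qed
  ultimately show ?case
    using ins(1) by (intro exI[of _ P']) auto
qed

lemma orth_proj_is_orth_proj:
  fixes X :: "real mat"
  assumes X: "X \<in> carrier_mat n p" and rank: "vec_space.rank n X = p" and k: "k \<le> p"
  shows "is_orth_proj n (LinearCombinations.module.span class_ring (module_vec TYPE(real) n) (set (take k (cols X)))) (orth_proj X k)"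
    and "i < n \<Longrightarrow> j < n \<Longrightarrow> orth_proj X k $$ (i, j) = orth_proj X k $$ (j, i)"
    and "(\<Sum>i<n. orth_proj X k $$ (i, i)) = real k"
proof -
  interpret V: vec_space "TYPE(real)" n .
  let ?W = "set (take k (cols X))"
  have W: "?W \<subseteq> carrier_vec n"
    using X cols_dim set_take_subset[of k "cols X"] by fastforce
  obtain P where P: "is_orth_proj n (V.span ?W) P"
    and sym: "\<forall>i<n. \<forall>j<n. P $$ (i, j) = P $$ (j, i)" and tr: "(\<Sum>i<n. P $$ (i, i)) = real k"
    using orth_proj_exists[OF assms] by blast
  have "orth_proj X k = (THE P. is_orth_proj n (V.span ?W) P)"
    using X by (simp add: orth_proj_def is_orth_proj_def Let_def)
  also have "\<dots> = P"
    using P by (rule the_equality) (rule orth_proj_unique[OF W _ P])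
  finally have "orth_proj X k = P" .
  with P sym tr show "is_orth_proj n (V.span ?W) (orth_proj X k)"
    "i < n \<Longrightarrow> j < n \<Longrightarrow> orth_proj X k $$ (i, j) = orth_proj X k $$ (j, i)"
    "(\<Sum>i<n. orth_proj X k $$ (i, i)) = real k"
    by auto
qed

lemma orth_proj_carrier:
  assumes "X \<in> carrier_mat n p" "vec_space.rank n X = p" "k \<le> p"
  shows "orth_proj X k \<in> carrier_mat n n"
  using orth_proj_is_orth_proj(1)[OF assms] by (simp add: is_orth_proj_def)

text \<open>The projection onto the larger span fixes the range of the one onto the smaller span.
  The opposite order of the factors follows by transposition, as both are symmetric.\<close>

lemma orth_proj_mult:
  fixes X :: "real mat"
  assumes X: "X \<in> carrier_mat n p" and rank: "vec_space.rank n X = p" and jk: "j \<le> p" "k \<le> p"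
    and il: "i < n" "l < n"
  shows "(\<Sum>m<n. orth_proj X j $$ (i, m) * orth_proj X k $$ (m, l)) = orth_proj X (min j k) $$ (i, l)"
proof -
  interpret V: vec_space "TYPE(real)" n .
  let ?P = "orth_proj X"
  have le: "(\<Sum>m<n. ?P b $$ (i, m) * ?P a $$ (m, l)) = ?P a $$ (i, l)"
    if "a \<le> b" "b \<le> p" "i < n" "l < n" for a b i l
  proof -
    let ?W = "\<lambda>k. set (take k (cols X))"
    have W: "?W b \<subseteq> carrier_vec n"
      using X cols_dim set_take_subset[of b "cols X"] by fastforce
    have c: "?P a \<in> carrier_mat n n" "?P b \<in> carrier_mat n n"
      using orth_proj_carrier[OF X rank] that by auto
    have "?P b * ?P a = ?P a"
    proof (rule eq_mat_on_vecs[of _ n])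
      fix v :: "real vec" assume v: "v \<in> carrier_vec n"
      have "?P a *\<^sub>v v \<in> V.span (?W a)"
        using orth_proj_is_orth_proj(1)[OF X rank, of a] that v by (simp add: is_orth_proj_def)
      also have "V.span (?W a) \<subseteq> V.span (?W b)"
        using that by (intro V.span_is_monotone set_take_subset_set_take)
      finally have "?P b *\<^sub>v (?P a *\<^sub>v v) = ?P a *\<^sub>v v"
        using orth_proj_fixes[OF W orth_proj_is_orth_proj(1)[OF X rank]] that by simp
      then show "(?P b * ?P a) *\<^sub>v v = ?P a *\<^sub>v v"
        using assoc_mult_mat_vec[OF c(2,1) v] by simp
    qed (use c in auto)
    then have "(?P b * ?P a) $$ (i, l) = ?P a $$ (i, l)"
      by simp
    then show ?thesis
      using c that by (simp add: scalar_prod_def atLeast0LessThan)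
  qed
  show ?thesis
  proof (cases "j \<le> k")
    case True
    have "(\<Sum>m<n. ?P j $$ (i, m) * ?P k $$ (m, l)) = (\<Sum>m<n. ?P k $$ (l, m) * ?P j $$ (m, i))"
    proof (intro sum.cong refl)
      fix m assume "m \<in> {..<n}"
      then show "?P j $$ (i, m) * ?P k $$ (m, l) = ?P k $$ (l, m) * ?P j $$ (m, i)"
        using orth_proj_is_orth_proj(2)[OF X rank jk(1), of i m]
          orth_proj_is_orth_proj(2)[OF X rank jk(2), of m l] il by simp
    qed
    also have "\<dots> = ?P j $$ (i, l)"
      using le[OF True jk(2) il(2,1)] orth_proj_is_orth_proj(2)[OF X rank jk(1) il] by simp
    finally show ?thesis
      using True by (simp add: min_def)
  next
    case False
    then show ?thesis
      using le[of k j i l] jk il by (simp add: min_def)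
  qed
qed

section \<open>Decomposition of the loss into blocks\<close>

lemma cand_size_0 [simp]: "cand_size M 0 = 0"
  by (simp add: cand_size_def)

lemma cand_size_less:
  assumes M: "finite M" "0 \<notin> M" and ab: "a < b" "b \<le> card M"
  shows "cand_size M a < cand_size M b"
proof -
  \<comment> \<open>The prefixed k_0 = 0 keeps the list strictly increasing because 0 is not a
    candidate size.\<close>
  have "sorted_wrt (<) (0 # sorted_list_of_set M)"
    using M strict_sorted_list_of_set[of M] by (auto intro: gr0I)
  from sorted_wrt_nth_less[OF this ab(1)] ab(2) show ?thesis
    by (simp add: cand_size_def)
qed

lemma cand_size_le:
  assumes M: "M \<subseteq> {1..p}" and m: "m \<le> card M"
  shows "cand_size M m \<le> p"
proof (cases m)
  case (Suc k)
  have "finite M"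
    using M finite_subset by blast
  moreover have "sorted_list_of_set M ! k \<in> set (sorted_list_of_set M)"
    using m Suc by (intro nth_mem) simp
  ultimately show ?thesis
    using M Suc by (auto simp: cand_size_def)
qed simp

text \<open>Abel summation: weights on the nested fits become tail sums of weights on their
  increments, the blocks.\<close>

lemma sum_by_parts:
  fixes w q :: "nat \<Rightarrow> real"
  assumes "q 0 = 0"
  shows "(\<Sum>m = 1..r. w m * q m) = (\<Sum>m = 1..r. (\<Sum>j = m..r. w j) * (q m - q (m - 1)))"
proof (induction r)
  case (Suc r)
  have "(\<Sum>m = 1..Suc r. (\<Sum>j = m..Suc r. w j) * (q m - q (m - 1)))
      = (\<Sum>m = 1..Suc r. (\<Sum>j = m..r. w j) * (q m - q (m - 1)))
        + w (Suc r) * (\<Sum>m = 1..Suc r. q m - q (m - 1))"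
    unfolding sum_distrib_left sum.distrib[symmetric]
    by (intro sum.cong refl) (simp add: algebra_simps)
  also have "(\<Sum>m = 1..Suc r. q m - q (m - 1)) = q (Suc r)"
    using sum_telescope''[of 0 "Suc r" q] assms by (simp add: atLeastSucAtMost_greaterThanAtMost)
  finally show ?case
    using Suc by simp
qed simp

text \<open>A telescoping sum, inverse to the passage in \<open>sum_by_parts\<close>: it recovers
  weights from prescribed block factors.\<close>

lemma weights_of_tails:
  fixes \<gamma> :: "nat \<Rightarrow> real"
  assumes "\<gamma> (Suc r) = 0" "m \<le> Suc r"
  shows "(\<Sum>j = m..r. \<gamma> j - \<gamma> (Suc j)) = \<gamma> m"
  using sum_Suc_diff'[of m "Suc r" "\<lambda>j. - \<gamma> j"] assms
  by (simp add: atLeastLessThanSuc_atLeastAtMost)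

lemma sum_squares_orthogonal:
  fixes f :: "'b \<Rightarrow> 'c \<Rightarrow> real"
  assumes S: "finite S"
    and orth: "\<And>a b. a \<in> S \<Longrightarrow> b \<in> S \<Longrightarrow> a \<noteq> b \<Longrightarrow> (\<Sum>i\<in>I. f a i * f b i) = 0"
  shows "(\<Sum>i\<in>I. (\<Sum>a\<in>S. f a i)\<^sup>2) = (\<Sum>a\<in>S. \<Sum>i\<in>I. (f a i)\<^sup>2)"
proof -
  have "(\<Sum>i\<in>I. (\<Sum>a\<in>S. f a i)\<^sup>2) = (\<Sum>i\<in>I. \<Sum>a\<in>S. \<Sum>b\<in>S. f a i * f b i)"
    by (simp add: power2_eq_square sum_product)
  also have "\<dots> = (\<Sum>a\<in>S. \<Sum>i\<in>I. \<Sum>b\<in>S. f a i * f b i)"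
    by (rule sum.swap)
  also have "\<dots> = (\<Sum>a\<in>S. \<Sum>b\<in>S. \<Sum>i\<in>I. f a i * f b i)"
    by (intro sum.cong refl sum.swap)
  also have "\<dots> = (\<Sum>a\<in>S. \<Sum>b\<in>S. if b = a then \<Sum>i\<in>I. (f a i)\<^sup>2 else 0)"
    by (intro sum.cong refl) (auto simp: orth power2_eq_square)
  also have "\<dots> = (\<Sum>a\<in>S. \<Sum>i\<in>I. (f a i)\<^sup>2)"
    using S by (simp add: sum.delta)
  finally show ?thesis .
qed

lemma index_mult_mat_vec_sum:
  fixes A :: "real mat"
  assumes "A \<in> carrier_mat n n" "v \<in> carrier_vec n" "i < n"
  shows "(A *\<^sub>v v) $ i = (\<Sum>j<n. A $$ (i, j) * v $ j)"
  using assms by (simp add: scalar_prod_def atLeast0LessThan)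

locale nested_models =
  fixes n p :: nat and X :: "real mat" and M :: "nat set" and \<mu> :: "real vec" and \<sigma> :: real
  assumes sigma_pos: "\<sigma> > 0"
    and X: "X \<in> carrier_mat n p"
    and rank: "vec_space.rank n X = p"
    and M: "M \<subseteq> {1..p}"
    and \<mu>: "\<mu> \<in> carrier_vec n"
begin

abbreviation "P m \<equiv> orth_proj X (cand_size M m)"

text \<open>The matrix of block m as an array of reals, the form to which
  \<open>noisy_projection\<close> applies.\<close>

definition D :: "nat \<Rightarrow> nat \<Rightarrow> nat \<Rightarrow> real" where
  "D m i j = P m $$ (i, j) - P (m - 1) $$ (i, j)"

abbreviation "mean \<equiv> \<lambda>i. \<mu> $ i"
abbreviation "proj m \<equiv> noisy_projection.proj n (D m)"
abbreviation "obs m \<equiv> noisy_projection.obs n (D m) mean"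
abbreviation "\<theta> m \<equiv> noisy_projection.\<theta> n (D m) mean"
abbreviation "signal m \<equiv> noisy_projection.signal n (D m) mean"
abbreviation "energy m \<equiv> noisy_projection.energy n (D m) mean"

text \<open>Since P_0 = 0, the means of the blocks add up to the projection of \<mu> by the largest
  candidate. This is the squared distance of \<mu> from it, which no choice of factors
  changes.\<close>

definition bias :: real where
  "bias = (\<Sum>i<n. (mean i - (\<Sum>m = 1..card M. \<theta> m i))\<^sup>2)"

lemma finite_M: "finite M"
  using M finite_subset by blast

lemma cand_mono: "a < b \<Longrightarrow> b \<le> card M \<Longrightarrow> cand_size M a < cand_size M b"
  using finite_M M by (intro cand_size_less) auto

lemma cand_le: "m \<le> card M \<Longrightarrow> cand_size M m \<le> p"
  using M by (rule cand_size_le)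

lemma P_carrier: "m \<le> card M \<Longrightarrow> P m \<in> carrier_mat n n"
  by (intro orth_proj_carrier[OF X rank] cand_le)

lemma P_mult:
  assumes "a \<le> card M" "b \<le> card M" "i < n" "l < n"
  shows "(\<Sum>k<n. P a $$ (i, k) * P b $$ (k, l)) = P (min a b) $$ (i, l)"
proof -
  have "min (cand_size M a) (cand_size M b) = cand_size M (min a b)"
    using cand_mono[of a b] cand_mono[of b a] assms(1,2) by (cases a b rule: linorder_cases) auto
  then show ?thesis
    using orth_proj_mult[OF X rank cand_le[OF assms(1)] cand_le[OF assms(2)] assms(3,4)] by simp
qed

lemma P_0:
  assumes "i < n" "j < n"
  shows "P 0 $$ (i, j) = 0"
proof -
  interpret V: vec_space "TYPE(real)" n .
  have "is_orth_proj n (V.span {}) (P 0)"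
    using orth_proj_is_orth_proj(1)[OF X rank, of 0] by simp
  then have "P 0 *\<^sub>v unit_vec n j = 0\<^sub>v n"
    using V.span_empty by (auto simp: is_orth_proj_def)
  then have "(P 0 *\<^sub>v unit_vec n j) $ i = 0"
    using assms by simp
  with assms P_carrier[of 0] show ?thesis
    by simp
qed

lemma D_sym: "m \<le> card M \<Longrightarrow> i < n \<Longrightarrow> j < n \<Longrightarrow> D m i j = D m j i"
  unfolding D_def
  using orth_proj_is_orth_proj(2)[OF X rank cand_le, of m i j]
    orth_proj_is_orth_proj(2)[OF X rank cand_le, of "m - 1" i j] by simp

text \<open>The four products collapse to projections at minima of indices. For a \<noteq> b these
  cancel in pairs.\<close>

lemma D_mult:
  assumes ab: "a \<in> {1..card M}" "b \<in> {1..card M}" and il: "i < n" "l < n"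
  shows "(\<Sum>k<n. D a i k * D b k l) = (if a = b then D a i l else 0)"
proof -
  have "(\<Sum>k<n. D a i k * D b k l) =
      (\<Sum>k<n. P a $$ (i, k) * P b $$ (k, l)) - (\<Sum>k<n. P a $$ (i, k) * P (b - 1) $$ (k, l))
      - (\<Sum>k<n. P (a - 1) $$ (i, k) * P b $$ (k, l)) + (\<Sum>k<n. P (a - 1) $$ (i, k) * P (b - 1) $$ (k, l))"
    by (simp add: D_def algebra_simps sum.distrib sum_subtractf)
  also have "\<dots> = P (min a b) $$ (i, l) - P (min a (b - 1)) $$ (i, l)
      - P (min (a - 1) b) $$ (i, l) + P (min (a - 1) (b - 1)) $$ (i, l)"
  proof -
    have "a \<le> card M" "b \<le> card M" "a - 1 \<le> card M" "b - 1 \<le> card M"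
      using ab by auto
    then show ?thesis
      using il by (simp only: P_mult)
  qed
  also have "\<dots> = (if a = b then D a i l else 0)"
  proof (cases a b rule: linorder_cases)
    case less
    then have "min a b = a" "min a (b - 1) = a" "min (a - 1) b = a - 1" "min (a - 1) (b - 1) = a - 1"
      by auto
    with less show ?thesis
      by simp
  next
    case equal
    then show ?thesis
      by (simp add: D_def)
  next
    case greater
    then have "min a b = b" "min a (b - 1) = b - 1" "min (a - 1) b = b" "min (a - 1) (b - 1) = b - 1"
      by auto
    with greater show ?thesis
      by simp
  qed
  finally show ?thesis .
qed

lemma block_projection:
  assumes "m \<in> {1..card M}"
  shows "noisy_projection n (D m) \<sigma>"
proof
  show "D m i j = D m j i" if "i < n" "j < n" for i j
    using assms that by (intro D_sym) auto
qed (use assms sigma_pos D_mult[OF assms assms] in auto)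

lemma block_len_pos: "m \<in> {1..card M} \<Longrightarrow> block_len M m > 0"
  using cand_mono[of "m - 1" m] by (simp add: block_len_def)

lemma D_trace:
  assumes "m \<in> {1..card M}"
  shows "noisy_projection.tr n (D m) = real (block_len M m)"
proof -
  interpret B: noisy_projection n "D m" mean \<sigma>
    by (rule block_projection[OF assms])
  have m: "m \<le> card M" "m - 1 \<le> card M"
    using assms by auto
  have "B.tr = real (cand_size M m) - real (cand_size M (m - 1))"
    unfolding B.tr_def
    using orth_proj_is_orth_proj(3)[OF X rank cand_le[OF m(1)]]
      orth_proj_is_orth_proj(3)[OF X rank cand_le[OF m(2)]]
    by (simp add: D_def sum_subtractf)
  moreover have "cand_size M (m - 1) < cand_size M m"
    using assms by (intro cand_mono) auto
  ultimately show ?thesis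
    by (simp add: block_len_def)
qed

lemma blocks_orthogonal:
  assumes ab: "a \<in> {1..card M}" "b \<in> {1..card M}" "a \<noteq> b"
  shows "(\<Sum>i<n. proj a u i * proj b v i) = 0"
proof -
  interpret A: noisy_projection n "D a" mean \<sigma>
    by (rule block_projection[OF ab(1)])
  interpret B: noisy_projection n "D b" mean \<sigma>
    by (rule block_projection[OF ab(2)])
  have "A.proj (B.proj v) i = 0" if i: "i < n" for i
  proof -
    have "A.proj (B.proj v) i = (\<Sum>k<n. \<Sum>j<n. D a i k * (D b k j * v j))"
      by (simp add: A.proj_def B.proj_def sum_distrib_left)
    also have "\<dots> = (\<Sum>j<n. \<Sum>k<n. D a i k * (D b k j * v j))"
      by (rule sum.swap)
    also have "\<dots> = (\<Sum>j<n. (\<Sum>k<n. D a i k * D b k j) * v j)"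
      by (simp add: sum_distrib_right mult.assoc)
    also have "\<dots> = 0"
      using ab i by (simp add: D_mult)
    finally show ?thesis .
  qed
  then have "(\<Sum>i<n. u i * A.proj (B.proj v) i) = 0"
    by simp
  then show ?thesis
    unfolding A.sum_proj_swap .
qed

text \<open>Pythagoras, pointwise in \<open>x\<close>: the factors may depend on the noise, so both
  the random Stein factors and the tail sums of fixed weights are covered.\<close>

lemma loss_decomposition:
  "(\<Sum>i<n. ((\<Sum>m = 1..card M. \<gamma> m * obs m x i) - mean i)\<^sup>2)
    = (\<Sum>m = 1..card M. \<Sum>i<n. (\<gamma> m * obs m x i - \<theta> m i)\<^sup>2) + bias"
proof -
  \<comment> \<open>The error within a block is written as the projection of a single vector, so
    that \<open>blocks_orthogonal\<close> and \<open>sum_proj_proj\<close> apply to it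
    directly.\<close>
  define f where "f m = proj m (\<lambda>j. \<gamma> m * (mean j + x j) - mean j)" for m
  define b where "b i = mean i - (\<Sum>m = 1..card M. \<theta> m i)" for i
  have f: "f m i = \<gamma> m * obs m x i - \<theta> m i" if "m \<in> {1..card M}" for m i
  proof -
    interpret B: noisy_projection n "D m" mean \<sigma>
      by (rule block_projection[OF that])
    show ?thesis
      unfolding f_def B.obs_def B.\<theta>_def B.proj_def
      by (simp add: algebra_simps sum.distrib sum_subtractf sum_distrib_left)
  qed
  have fb: "(\<Sum>i<n. f a i * b i) = 0" if a: "a \<in> {1..card M}" for a
  proof -
    interpret A: noisy_projection n "D a" mean \<sigma>
      by (rule block_projection[OF a])
    have "(\<Sum>i<n. f a i * b i) = (\<Sum>i<n. f a i * mean i) - (\<Sum>i<n. \<Sum>m = 1..card M. f a i * \<theta> m i)"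
      by (simp add: b_def right_diff_distrib sum_subtractf sum_distrib_left)
    also have "(\<Sum>i<n. \<Sum>m = 1..card M. f a i * \<theta> m i) = (\<Sum>m = 1..card M. \<Sum>i<n. f a i * \<theta> m i)"
      by (rule sum.swap)
    also have "\<dots> = (\<Sum>m = 1..card M. if m = a then \<Sum>i<n. f a i * \<theta> a i else 0)"
    proof (intro sum.cong refl)
      fix m assume m: "m \<in> {1..card M}"
      interpret B: noisy_projection n "D m" mean \<sigma>
        by (rule block_projection[OF m])
      show "(\<Sum>i<n. f a i * \<theta> m i) = (if m = a then \<Sum>i<n. f a i * \<theta> a i else 0)"
        using blocks_orthogonal[OF a m] unfolding f_def B.\<theta>_def A.\<theta>_def by auto
    qed
    also have "\<dots> = (\<Sum>i<n. f a i * \<theta> a i)"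
      using a by (simp add: sum.delta)
    also have "\<dots> = (\<Sum>i<n. f a i * mean i)"
      unfolding f_def A.\<theta>_def by (rule A.sum_proj_proj)
    finally show ?thesis
      by simp
  qed
  define F where "F i = (\<Sum>m = 1..card M. f m i)" for i
  have "(\<Sum>i<n. F i * b i) = (\<Sum>m = 1..card M. \<Sum>i<n. f m i * b i)"
    unfolding F_def sum_distrib_right by (rule sum.swap)
  then have Fb: "(\<Sum>i<n. F i * b i) = 0"
    using fb by simp
  have "(\<Sum>m = 1..card M. \<gamma> m * obs m x i) - mean i = F i - b i" for i
    by (simp add: F_def b_def f sum_subtractf)
  then have "(\<Sum>i<n. ((\<Sum>m = 1..card M. \<gamma> m * obs m x i) - mean i)\<^sup>2)
      = (\<Sum>i<n. (F i)\<^sup>2) - 2 * (\<Sum>i<n. F i * b i) + (\<Sum>i<n. (b i)\<^sup>2)"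
    by (simp add: power2_diff sum.distrib sum_subtractf sum_distrib_left mult.assoc)
  also have "(\<Sum>i<n. (F i)\<^sup>2) = (\<Sum>m = 1..card M. \<Sum>i<n. (f m i)\<^sup>2)"
    unfolding F_def
    by (rule sum_squares_orthogonal) (auto simp: f_def intro!: blocks_orthogonal)
  also have "\<dots> = (\<Sum>m = 1..card M. \<Sum>i<n. (\<gamma> m * obs m x i - \<theta> m i)\<^sup>2)"
    by (intro sum.cong refl) (simp add: f)
  finally show ?thesis
    unfolding Fb unfolding bias_def b_def by simp
qed

text \<open>The bridge from vectors to coordinate functions. Agreement below n suffices, because
  \<open>x\<close> will be the noise restricted to these indices.\<close>

context
  fixes e :: "real vec" and x :: "nat \<Rightarrow> real"
  assumes e: "e \<in> carrier_vec n" and x: "\<And>i. i < n \<Longrightarrow> x i = e $ i"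
begin

lemma ls_fit_diff:
  assumes m: "m \<in> {1..card M}" and i: "i < n"
  shows "ls_fit X (cand_size M m) (\<mu> + e) $ i - ls_fit X (cand_size M (m - 1)) (\<mu> + e) $ i = obs m x i"
proof -
  interpret B: noisy_projection n "D m" mean \<sigma>
    by (rule block_projection[OF m])
  have c: "\<mu> + e \<in> carrier_vec n" "P m \<in> carrier_mat n n" "P (m - 1) \<in> carrier_mat n n"
    using \<mu> e m by (auto intro!: P_carrier)
  have "obs m x i = (\<Sum>j<n. D m i j * (\<mu> + e) $ j)"
    unfolding B.obs_def B.proj_def using \<mu> e x by (intro sum.cong refl) auto
  then show ?thesis
    unfolding ls_fit_def index_mult_mat_vec_sum[OF c(2,1) i] index_mult_mat_vec_sum[OF c(3,1) i]
    by (simp add: D_def left_diff_distrib sum_subtractf)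
qed

lemma block_vec_index:
  assumes m: "m \<in> {1..card M}" and i: "i < n"
  shows "block_vec X M (\<mu> + e) m $ i = obs m x i"
proof -
  have c: "\<mu> + e \<in> carrier_vec n" "P m \<in> carrier_mat n n" "P (m - 1) \<in> carrier_mat n n"
    using \<mu> e m by (auto intro!: P_carrier)
  have "block_vec X M (\<mu> + e) m $ i = (P m *\<^sub>v (\<mu> + e) - P (m - 1) *\<^sub>v (\<mu> + e)) $ i"
    unfolding block_vec_def by (subst minus_mult_distrib_mat_vec[OF c(2,3,1)]) simp
  also have "\<dots> = obs m x i"
    using ls_fit_diff[OF m i] c i by (simp add: ls_fit_def)
  finally show ?thesis .
qed

lemma block_vec_carrier:
  assumes "m \<in> {1..card M}"
  shows "block_vec X M (\<mu> + e) m \<in> carrier_vec n"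
proof -
  have "P (m - 1) \<in> carrier_mat n n"
    using assms by (intro P_carrier) auto
  then have "P m - P (m - 1) \<in> carrier_mat n n"
    by (rule minus_carrier_mat)
  then show ?thesis
    unfolding block_vec_def using \<mu> e by (intro mult_mat_vec_carrier[of _ n n]) auto
qed

lemma sq_norm_block_vec:
  assumes m: "m \<in> {1..card M}"
  shows "sq_norm (block_vec X M (\<mu> + e) m) = energy m x"
proof -
  interpret B: noisy_projection n "D m" mean \<sigma>
    by (rule block_projection[OF m])
  show ?thesis
    unfolding sq_norm_def B.energy_def scalar_prod_def
    using block_vec_carrier[OF m] by (simp add: block_vec_index[OF m] power2_eq_square atLeast0LessThan)
qed

lemma sq_norm_finsum_minus:
  assumes v: "\<And>m. m \<in> {1..card M} \<Longrightarrow> v m \<in> carrier_vec n"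
  shows "sq_norm (finsum_vec TYPE(real) (dim_row X) v {1..card M} - \<mu>)
    = (\<Sum>i<n. ((\<Sum>m = 1..card M. v m $ i) - mean i)\<^sup>2)"
proof -
  have dim: "dim_row X = n"
    using X by simp
  have "finsum_vec TYPE(real) n v {1..card M} \<in> carrier_vec n"
    using v by (intro finsum_vec_closed) auto
  then show ?thesis
    using \<mu> v unfolding sq_norm_def scalar_prod_def dim
    by (simp add: index_finsum_vec Pi_iff power2_eq_square atLeast0LessThan)
qed

lemma stein_loss:
  "sq_norm (stein_fit \<sigma> \<phi> X M (\<mu> + e) - \<mu>)
    = (\<Sum>m = 1..card M. \<Sum>i<n.
        (max (1 - real (block_len M m) * \<sigma>\<^sup>2 * (1 + \<phi> m) / energy m x) 0 * obs m x i - \<theta> m i)\<^sup>2) + bias"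
proof -
  let ?\<gamma> = "\<lambda>m. max (1 - real (block_len M m) * \<sigma>\<^sup>2 * (1 + \<phi> m) / energy m x) 0"
  have "sq_norm (stein_fit \<sigma> \<phi> X M (\<mu> + e) - \<mu>)
      = (\<Sum>i<n. ((\<Sum>m = 1..card M. (stein_factor \<sigma> \<phi> X M (\<mu> + e) m \<cdot>\<^sub>v block_vec X M (\<mu> + e) m) $ i) - mean i)\<^sup>2)"
    unfolding stein_fit_def by (rule sq_norm_finsum_minus) (simp add: block_vec_carrier)
  also have "\<dots> = (\<Sum>i<n. ((\<Sum>m = 1..card M. ?\<gamma> m * obs m x i) - mean i)\<^sup>2)"
  proof (intro sum.cong refl arg_cong[where f = "\<lambda>z. (z - _)\<^sup>2"])
    fix i m assume i: "i \<in> {..<n}" and m: "m \<in> {1..card M}"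
    show "(stein_factor \<sigma> \<phi> X M (\<mu> + e) m \<cdot>\<^sub>v block_vec X M (\<mu> + e) m) $ i = ?\<gamma> m * obs m x i"
      using i block_vec_carrier[OF m] block_vec_index[OF m]
      by (simp add: stein_factor_def sq_norm_block_vec[OF m])
  qed
  also have "\<dots> = (\<Sum>m = 1..card M. \<Sum>i<n. (?\<gamma> m * obs m x i - \<theta> m i)\<^sup>2) + bias"
    by (rule loss_decomposition)
  finally show ?thesis .
qed

lemma averaged_loss:
  "sq_norm (averaged_fit X M w (\<mu> + e) - \<mu>)
    = (\<Sum>m = 1..card M. \<Sum>i<n. ((\<Sum>j = m..card M. w j) * obs m x i - \<theta> m i)\<^sup>2) + bias"
proof -
  let ?\<gamma> = "\<lambda>m. \<Sum>j = m..card M. w j"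
  let ?fit = "\<lambda>m. ls_fit X (cand_size M m) (\<mu> + e)"
  have fit: "?fit m \<in> carrier_vec n" if "m \<le> card M" for m
    unfolding ls_fit_def using P_carrier[OF that] \<mu> e by (intro mult_mat_vec_carrier[of _ n n]) auto
  have "sq_norm (averaged_fit X M w (\<mu> + e) - \<mu>)
      = (\<Sum>i<n. ((\<Sum>m = 1..card M. (w m \<cdot>\<^sub>v ?fit m) $ i) - mean i)\<^sup>2)"
    unfolding averaged_fit_def by (rule sq_norm_finsum_minus) (simp add: fit)
  also have "\<dots> = (\<Sum>i<n. ((\<Sum>m = 1..card M. ?\<gamma> m * obs m x i) - mean i)\<^sup>2)"
  proof (intro sum.cong refl)
    fix i assume "i \<in> {..<n}"
    then have i: "i < n"
      by simp
    have c: "\<mu> + e \<in> carrier_vec n"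
      using \<mu> e by simp
    \<comment> \<open>The boundary term of the summation by parts vanishes thanks to P_0 =
      0.\<close>
    have fit_0: "?fit 0 $ i = 0"
      using index_mult_mat_vec_sum[OF P_carrier[of 0] c i] i by (simp add: ls_fit_def P_0[simplified])
    have "(\<Sum>m = 1..card M. (w m \<cdot>\<^sub>v ?fit m) $ i) = (\<Sum>m = 1..card M. w m * ?fit m $ i)"
    proof (intro sum.cong refl)
      fix m assume "m \<in> {1..card M}"
      then have "dim_vec (?fit m) = n"
        using fit[of m] by (simp only: carrier_vecD atLeastAtMost_iff)
      with i show "(w m \<cdot>\<^sub>v ?fit m) $ i = w m * ?fit m $ i"
        by simp
    qed
    also have "\<dots> = (\<Sum>m = 1..card M. ?\<gamma> m * (?fit m $ i - ?fit (m - 1) $ i))"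
      using fit_0 by (rule sum_by_parts)
    also have "\<dots> = (\<Sum>m = 1..card M. ?\<gamma> m * obs m x i)"
      by (intro sum.cong refl) (simp only: ls_fit_diff[OF _ i])
    finally show "((\<Sum>m = 1..card M. (w m \<cdot>\<^sub>v ?fit m) $ i) - mean i)\<^sup>2
        = ((\<Sum>m = 1..card M. ?\<gamma> m * obs m x i) - mean i)\<^sup>2"
      by simp
  qed
  also have "\<dots> = (\<Sum>m = 1..card M. \<Sum>i<n. (?\<gamma> m * obs m x i - \<theta> m i)\<^sup>2) + bias"
    by (rule loss_decomposition)
  finally show ?thesis .
qed

end

end

section \<open>The oracle inequality\<close>

text \<open>Independence and normal marginals together determine the joint law of the noise as
  \<open>noise_measure\<close>; the rest is a change of variables.\<close>

lemma noise_integral: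
  fixes \<Omega> :: "'a measure" and e :: "nat \<Rightarrow> 'a \<Rightarrow> real" and f :: "(nat \<Rightarrow> real) \<Rightarrow> real"
  assumes prob: "prob_space \<Omega>" and n: "n > 0"
    and indep: "prob_space.indep_vars \<Omega> (\<lambda>_. borel) e {..<n}"
    and normal: "\<And>i. i < n \<Longrightarrow> distributed \<Omega> lborel (e i) (normal_density 0 \<sigma>)"
    and f: "f \<in> borel_measurable (noise_measure n \<sigma>)"
  shows "(\<integral>\<omega>. f (\<lambda>i\<in>{..<n}. e i \<omega>) \<partial>\<Omega>) = (\<integral>x. f x \<partial>noise_measure n \<sigma>)"
proof -
  interpret prob_space \<Omega>
    by (rule prob)
  let ?B = "\<Pi>\<^sub>M i\<in>{..<n}. (borel :: real measure)" and ?e = "\<lambda>\<omega>. \<lambda>i\<in>{..<n}. e i \<omega>"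
  have meas: "e i \<in> borel_measurable \<Omega>" if "i < n" for i
    using distributed_measurable[OF normal[OF that]] by simp
  have law: "distr \<Omega> borel (e i) = normal_measure \<sigma>" if "i < n" for i
  proof -
    have "distr \<Omega> borel (e i) = distr \<Omega> lborel (e i)"
      by (rule distr_cong) auto
    also have "\<dots> = normal_measure \<sigma>"
      using distributed_distr_eq_density[OF normal[OF that]] by (simp add: normal_measure_def)
    finally show ?thesis .
  qed
  have "distr \<Omega> ?B ?e = (\<Pi>\<^sub>M i\<in>{..<n}. distr \<Omega> borel (e i))"
    using indep n meas by (subst indep_vars_iff_distr_eq_PiM'[symmetric]) auto
  also have "\<dots> = noise_measure n \<sigma>"
    unfolding noise_measure_def by (intro PiM_cong) (auto simp: law)
  finally have distr: "distr \<Omega> ?B ?e = noise_measure n \<sigma>" .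
  have "sets (noise_measure n \<sigma>) = sets ?B"
    unfolding distr[symmetric] by simp
  then have f': "f \<in> borel_measurable ?B"
    using f by (simp cong: measurable_cong_sets)
  have "?e \<in> measurable \<Omega> ?B"
    by (intro measurable_restrict meas) simp
  from integral_distr[OF this f'] show ?thesis
    by (simp add: distr)
qed

text \<open>Completing the square in \<gamma> exhibits both the best factor A / (A + v) and the
  minimal risk v A / (A + v).\<close>

lemma shrinkage_risk_minimum:
  fixes A v \<gamma> :: real
  assumes "A + v \<noteq> 0"
  shows "(1 - \<gamma>)\<^sup>2 * A + \<gamma>\<^sup>2 * v = v * A / (A + v) + (A + v) * (\<gamma> - A / (A + v))\<^sup>2"
proof -
  define s g where "s = A + v" and "g = A / s"
  have A: "A = s * g" and v: "v = s * (1 - g)"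
    using assms by (simp_all add: s_def g_def field_simps)
  have "v * A / (A + v) = s * (1 - g) * g"
    using assms unfolding s_def[symmetric] by (simp add: A v)
  then show ?thesis
    unfolding s_def[symmetric] g_def[symmetric]
    by (simp add: A v power2_eq_square algebra_simps)
qed

context nested_models
begin

definition block_risk :: "nat \<Rightarrow> real \<Rightarrow> real" where
  "block_risk m \<gamma> = (1 - \<gamma>)\<^sup>2 * signal m + \<gamma>\<^sup>2 * (real (block_len M m) * \<sigma>\<^sup>2)"

text \<open>The value 0 outside the index range supplies the convention \<gamma> = 0 after the last
  block, on which the telescoping of \<open>oracle_weight\<close> relies.\<close>

definition oracle_factor :: "nat \<Rightarrow> real" where
  "oracle_factor m = (if m \<in> {1..card M} then signal m / (signal m + real (block_len M m) * \<sigma>\<^sup>2) else 0)"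

definition oracle_weight :: "nat \<Rightarrow> real" where
  "oracle_weight m = oracle_factor m - oracle_factor (Suc m)"

lemma signal_nonneg: "m \<in> {1..card M} \<Longrightarrow> signal m \<ge> 0"
  by (rule noisy_projection.signal_nonneg[OF block_projection])

lemma variance_pos: "m \<in> {1..card M} \<Longrightarrow> real (block_len M m) * \<sigma>\<^sup>2 > 0"
  using block_len_pos[of m] sigma_pos by simp

lemma block_risk_oracle:
  assumes "m \<in> {1..card M}"
  shows "block_risk m (oracle_factor m)
      = real (block_len M m) * \<sigma>\<^sup>2 * signal m / (signal m + real (block_len M m) * \<sigma>\<^sup>2)"
    and "block_risk m (oracle_factor m) \<le> block_risk m \<gamma>"
proof -
  let ?v = "real (block_len M m) * \<sigma>\<^sup>2"
  have pos: "signal m + ?v > 0"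
    using signal_nonneg[OF assms] variance_pos[OF assms] by simp
  have eq: "block_risk m \<gamma> = ?v * signal m / (signal m + ?v) + (signal m + ?v) * (\<gamma> - oracle_factor m)\<^sup>2" for \<gamma>
    using shrinkage_risk_minimum[of "signal m" ?v \<gamma>] pos assms
    by (simp add: block_risk_def oracle_factor_def)
  show "block_risk m (oracle_factor m) = ?v * signal m / (signal m + ?v)"
    by (simp add: eq)
  show "block_risk m (oracle_factor m) \<le> block_risk m \<gamma>"
    using pos by (simp add: eq)
qed

lemma oracle_tail: "m \<in> {1..card M} \<Longrightarrow> (\<Sum>j = m..card M. oracle_weight j) = oracle_factor m"
  unfolding oracle_weight_def by (rule weights_of_tails) (auto simp: oracle_factor_def)

text \<open>The relaxed set asks only that each tail sum lie in [0, 1], and every oracle factor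
  does. The factors need not decrease in m, so some weights may be negative.\<close>

lemma oracle_weight_relaxed: "oracle_weight \<in> relaxed_weights M"
proof -
  have "0 \<le> oracle_factor m \<and> oracle_factor m \<le> 1" if "m \<in> {1..card M}" for m
    using signal_nonneg[OF that] variance_pos[OF that] that
    by (auto simp: oracle_factor_def divide_le_eq_1)
  then show ?thesis
    by (simp add: relaxed_weights_def oracle_tail)
qed

context
  fixes \<Omega> :: "'a measure" and \<epsilon> :: "'a \<Rightarrow> real vec"
  assumes prob: "prob_space \<Omega>" and n_pos: "n > 0"
    and noise_dim: "\<And>\<omega>. \<omega> \<in> space \<Omega> \<Longrightarrow> \<epsilon> \<omega> \<in> carrier_vec n"
    and indep: "prob_space.indep_vars \<Omega> (\<lambda>_. borel) (\<lambda>i \<omega>. \<epsilon> \<omega> $ i) {..<n}"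
    and normal: "\<And>i. i < n \<Longrightarrow> distributed \<Omega> lborel (\<lambda>\<omega>. \<epsilon> \<omega> $ i) (normal_density 0 \<sigma>)"
begin

abbreviation "Q \<equiv> noise_measure n \<sigma>"

text \<open>One transfer to the canonical noise space, shared by the Stein fit and the averaged
  fits.\<close>

lemma expected_loss:
  fixes loss :: "real vec \<Rightarrow> real" and f :: "nat \<Rightarrow> (nat \<Rightarrow> real) \<Rightarrow> real"
  assumes loss: "\<And>e x. e \<in> carrier_vec n \<Longrightarrow> (\<And>i. i < n \<Longrightarrow> x i = e $ i) \<Longrightarrow>
      loss e = (\<Sum>m = 1..card M. f m x) + bias"
    and int: "\<And>m. m \<in> {1..card M} \<Longrightarrow> integrable Q (f m)"
  shows "(\<integral>\<omega>. loss (\<epsilon> \<omega>) \<partial>\<Omega>) = (\<Sum>m = 1..card M. \<integral>x. f m x \<partial>Q) + bias"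
proof -
  interpret Q: prob_space Q
    by (rule prob_space_noise_measure[OF sigma_pos])
  let ?F = "\<lambda>x. (\<Sum>m = 1..card M. f m x) + bias"
  have "integrable Q ?F"
    using int by (intro Bochner_Integration.integrable_add Bochner_Integration.integrable_sum) auto
  then have "?F \<in> borel_measurable Q"
    by simp
  from noise_integral[OF prob n_pos indep normal this]
  have "(\<integral>\<omega>. ?F (\<lambda>i\<in>{..<n}. \<epsilon> \<omega> $ i) \<partial>\<Omega>) = (\<integral>x. ?F x \<partial>Q)" .
  moreover have "(\<integral>\<omega>. loss (\<epsilon> \<omega>) \<partial>\<Omega>) = (\<integral>\<omega>. ?F (\<lambda>i\<in>{..<n}. \<epsilon> \<omega> $ i) \<partial>\<Omega>)"
    by (intro Bochner_Integration.integral_cong refl loss noise_dim) auto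
  moreover have "(\<integral>x. ?F x \<partial>Q) = (\<Sum>m = 1..card M. \<integral>x. f m x \<partial>Q) + bias"
  proof -
    have "(\<integral>x. ?F x \<partial>Q) = (\<integral>x. (\<Sum>m = 1..card M. f m x) \<partial>Q) + (\<integral>x. bias \<partial>Q)"
      using int by (intro Bochner_Integration.integral_add Bochner_Integration.integrable_sum) auto
    also have "(\<integral>x. (\<Sum>m = 1..card M. f m x) \<partial>Q) = (\<Sum>m = 1..card M. \<integral>x. f m x \<partial>Q)"
      using int by (intro Bochner_Integration.integral_sum) auto
    finally show ?thesis
      by (simp only: Q.prob_space lebesgue_integral_const) simp
  qed
  ultimately show ?thesis
    by simp
qed

lemma averaging_risk_eq:
  "averaging_risk \<Omega> \<epsilon> X M \<mu> w = (\<Sum>m = 1..card M. block_risk m (\<Sum>j = m..card M. w j)) + bias"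
proof -
  let ?f = "\<lambda>m x. \<Sum>i<n. ((\<Sum>j = m..card M. w j) * obs m x i - \<theta> m i)\<^sup>2"
  have "averaging_risk \<Omega> \<epsilon> X M \<mu> w = (\<Sum>m = 1..card M. \<integral>x. ?f m x \<partial>Q) + bias"
    unfolding averaging_risk_def
    by (rule expected_loss, rule averaged_loss, assumption, simp)
      (rule noisy_projection.linear_shrinkage_risk(1)[OF block_projection])
  moreover have "(\<integral>x. ?f m x \<partial>Q) = block_risk m (\<Sum>j = m..card M. w j)" if "m \<in> {1..card M}" for m
    using noisy_projection.linear_shrinkage_risk(2)[OF block_projection[OF that]]
    by (simp add: block_risk_def D_trace[OF that])
  ultimately show ?thesis
    by simp
qed

lemma averaging_risk_oracle:
  "averaging_risk \<Omega> \<epsilon> X M \<mu> oracle_weight = (\<Sum>m = 1..card M. block_risk m (oracle_factor m)) + bias"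
  by (simp add: averaging_risk_eq oracle_tail)

lemma oracle_optimal: "averaging_risk \<Omega> \<epsilon> X M \<mu> oracle_weight \<le> averaging_risk \<Omega> \<epsilon> X M \<mu> w"
  unfolding averaging_risk_oracle averaging_risk_eq[of w]
  by (intro add_right_mono sum_mono block_risk_oracle(2))

lemma stein_oracle_inequality:
  assumes \<phi>: "\<And>m. m \<in> {1..card M} \<Longrightarrow> 0 < \<phi> m \<and> \<phi> m < 1"
    and large: "\<And>m. m \<in> {1..card M} \<Longrightarrow> 1 / real (block_len M m) \<le> (1 - \<phi> m) / 4"
    and B: "\<And>m. m \<in> {1..card M} \<Longrightarrow> 2 * \<phi> m + 16 / (real (block_len M m) * \<phi> m) \<le> B" "B \<ge> 0"
    and c: "(\<Sum>m = 1..card M. exp (- (real (block_len M m) * (\<phi> m)\<^sup>2 / (16 * (1 + 2 * sqrt (\<phi> m))\<^sup>2)))) \<le> c"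
  shows "(\<integral>\<omega>. sq_norm (stein_fit \<sigma> \<phi> X M (\<mu> + \<epsilon> \<omega>) - \<mu>) \<partial>\<Omega>)
    \<le> (1 + B) * averaging_risk \<Omega> \<epsilon> X M \<mu> oracle_weight + 8 * c * \<sigma>\<^sup>2"
proof -
  let ?E = "\<lambda>m. exp (- (real (block_len M m) * (\<phi> m)\<^sup>2 / (16 * (1 + 2 * sqrt (\<phi> m))\<^sup>2)))"
  let ?f = "\<lambda>m x. \<Sum>i<n. (max (1 - real (block_len M m) * \<sigma>\<^sup>2 * (1 + \<phi> m) / energy m x) 0
    * obs m x i - \<theta> m i)\<^sup>2"
  have block: "integrable Q (?f m)"
      "(\<integral>x. ?f m x \<partial>Q) \<le> (1 + B) * block_risk m (oracle_factor m) + 8 * \<sigma>\<^sup>2 * ?E m"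
    if m: "m \<in> {1..card M}" for m
  proof -
    interpret B: noisy_projection n "D m" mean \<sigma>
      by (rule block_projection[OF m])
    have tr: "B.tr > 0" "1 / B.tr \<le> (1 - \<phi> m) / 4"
      using block_len_pos[OF m] large[OF m] by (simp_all add: D_trace[OF m])
    note risk = B.stein_block_risk[OF conjunct1[OF \<phi>[OF m]] conjunct2[OF \<phi>[OF m]] tr, unfolded D_trace[OF m]]
    show "integrable Q (?f m)"
      by (rule risk(1))
    have "block_risk m (oracle_factor m) \<ge> 0"
      using signal_nonneg[OF m] by (simp add: block_risk_def)
    \<comment> \<open>The relative errors of the blocks differ; as the block risks are nonnegative,
      the common bound \<open>B\<close> may replace each of them before summing.\<close>
    then have "(1 + (2 * \<phi> m + 16 / (real (block_len M m) * \<phi> m))) * block_risk m (oracle_factor m)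
        \<le> (1 + B) * block_risk m (oracle_factor m)"
      using B(1)[OF m] by (intro mult_right_mono) auto
    then show "(\<integral>x. ?f m x \<partial>Q) \<le> (1 + B) * block_risk m (oracle_factor m) + 8 * \<sigma>\<^sup>2 * ?E m"
      using risk(2) unfolding block_risk_oracle(1)[OF m] by linarith
  qed
  have "(\<integral>\<omega>. sq_norm (stein_fit \<sigma> \<phi> X M (\<mu> + \<epsilon> \<omega>) - \<mu>) \<partial>\<Omega>)
      = (\<Sum>m = 1..card M. \<integral>x. ?f m x \<partial>Q) + bias"
    by (rule expected_loss, rule stein_loss, assumption, simp, rule block(1))
  also have "\<dots> \<le> (\<Sum>m = 1..card M. (1 + B) * block_risk m (oracle_factor m) + 8 * \<sigma>\<^sup>2 * ?E m) + (1 + B) * bias"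
  proof (rule add_mono)
    have "bias \<ge> 0"
      unfolding bias_def by (simp add: sum_nonneg)
    with B(2) show "bias \<le> (1 + B) * bias"
      by (simp add: distrib_right)
  qed (intro sum_mono block)
  also have "\<dots> = (1 + B) * averaging_risk \<Omega> \<epsilon> X M \<mu> oracle_weight + 8 * \<sigma>\<^sup>2 * (\<Sum>m = 1..card M. ?E m)"
    unfolding averaging_risk_oracle by (simp add: sum.distrib sum_distrib_left[symmetric] distrib_left)
  also have "\<dots> \<le> (1 + B) * averaging_risk \<Omega> \<epsilon> X M \<mu> oracle_weight + 8 * \<sigma>\<^sup>2 * c"
    using c by (intro add_left_mono mult_left_mono) auto
  finally show ?thesis
    by (simp add: mult_ac)
qed

end

end

text \<open>The minimum over the relaxed weights is expressed by a minimiser, for which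
  \<open>oracle_weight\<close> is the witness: minimising each block separately already yields
  admissible weights.\<close>

theorem theorem2:
  fixes N :: nat
    and \<Omega> :: "nat \<Rightarrow> 'a measure"
    and \<epsilon> :: "nat \<Rightarrow> 'a \<Rightarrow> real vec"
    and X :: "nat \<Rightarrow> real mat"
    and p :: "nat \<Rightarrow> nat"
    and \<M> :: "nat \<Rightarrow> nat set"
    and \<phi> :: "nat \<Rightarrow> nat \<Rightarrow> real"
    and \<sigma> c\<^sub>1 :: real
  assumes sigma: "\<sigma> > 0"
    and prob: "\<And>n. n \<ge> N \<Longrightarrow> prob_space (\<Omega> n)"
    and noise_dim: "\<And>n \<omega>. n \<ge> N \<Longrightarrow> \<omega> \<in> space (\<Omega> n) \<Longrightarrow> \<epsilon> n \<omega> \<in> carrier_vec n"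
    and noise_indep: "\<And>n. n \<ge> N \<Longrightarrow>
      prob_space.indep_vars (\<Omega> n) (\<lambda>_. borel) (\<lambda>i \<omega>. \<epsilon> n \<omega> $ i) {..<n}"
    and noise_normal: "\<And>n i. n \<ge> N \<Longrightarrow> i < n \<Longrightarrow>
      distributed (\<Omega> n) lborel (\<lambda>\<omega>. \<epsilon> n \<omega> $ i) (normal_density 0 \<sigma>)"
    and design: "\<And>n. n \<ge> N \<Longrightarrow> X n \<in> carrier_mat n (p n)"
    and p_le: "\<And>n. n \<ge> N \<Longrightarrow> p n \<le> n"
    and full_rank: "\<And>n. n \<ge> N \<Longrightarrow> vec_space.rank n (X n) = p n"
    and models: "\<And>n. n \<ge> N \<Longrightarrow> \<M> n \<noteq> {} \<and> \<M> n \<subseteq> {1..p n}"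
    and penalty: "\<And>n m. n \<ge> N \<Longrightarrow> m \<in> {1..card (\<M> n)} \<Longrightarrow> 0 < \<phi> n m \<and> \<phi> n m < 1"
    and penalty_lim: "(\<lambda>n. MAX m\<in>{1..card (\<M> n)}. \<phi> n m) \<longlonglongrightarrow> 0"
    and cond_i: "\<And>n. n \<ge> N \<Longrightarrow>
      (\<Sum>m = 1..card (\<M> n).
         exp (- (real (block_len (\<M> n) m) * (\<phi> n m)\<^sup>2
                 / (16 * (1 + 2 * sqrt (\<phi> n m))\<^sup>2)))) \<le> c\<^sub>1"
    and cond_ii: "\<And>n m. n \<ge> N \<Longrightarrow> m \<in> {1..card (\<M> n)} \<Longrightarrow>
      1 / real (block_len (\<M> n) m) \<le> (1 - \<phi> n m) / 4"
  shows "\<forall>n \<ge> N. \<forall>\<beta> \<in> carrier_vec (p n).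
    let \<mu> = X n *\<^sub>v \<beta>;
        R = averaging_risk (\<Omega> n) (\<epsilon> n) (X n) (\<M> n) \<mu>;
        \<phi>bar = (MAX m\<in>{1..card (\<M> n)}. 2 * \<phi> n m + 16 / (real (block_len (\<M> n) m) * \<phi> n m))
    in \<exists>w \<in> relaxed_weights (\<M> n).
         (\<forall>v \<in> relaxed_weights (\<M> n). R w \<le> R v) \<and>
         (\<integral>\<omega>. sq_norm (stein_fit \<sigma> (\<phi> n) (X n) (\<M> n) (\<mu> + \<epsilon> n \<omega>) - \<mu>) \<partial>\<Omega> n)
           \<le> (1 + \<phi>bar) * R w + 8 * c\<^sub>1 * \<sigma>\<^sup>2"
proof (intro allI impI ballI)
  fix n :: nat and \<beta> :: "real vec"
  assume n: "n \<ge> N" and \<beta>: "\<beta> \<in> carrier_vec (p n)"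
  let ?M = "\<M> n" and ?\<mu> = "X n *\<^sub>v \<beta>"
  let ?b = "\<lambda>m. 2 * \<phi> n m + 16 / (real (block_len ?M m) * \<phi> n m)"
  let ?B = "MAX m\<in>{1..card ?M}. ?b m"
  interpret nested_models n "p n" "X n" ?M ?\<mu> \<sigma>
    using sigma design[OF n] full_rank[OF n] models[OF n] \<beta> by unfold_locales auto
  have "card ?M > 0"
    using models[OF n] finite_M by (simp add: card_gt_0_iff)
  then have ne: "1 \<in> {1..card ?M}"
    by simp
  \<comment> \<open>A nonempty set of candidates forces a column and hence a positive sample size,
    which the product form of the noise law requires.\<close>
  have "p n > 0"
    using models[OF n] by (cases "p n") auto
  then have n_pos: "n > 0"
    using p_le[OF n] by simp
  note noise = prob[OF n] n_pos noise_dim[OF n] noise_indep[OF n] noise_normal[OF n]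
  have B: "?b m \<le> ?B" if "m \<in> {1..card ?M}" for m
    using that by (intro Max_ge) auto
  have "0 \<le> ?b 1"
    using penalty[OF n ne] by simp
  also have "\<dots> \<le> ?B"
    by (rule B[OF ne])
  finally have B_nonneg: "?B \<ge> 0" .
  show "let \<mu> = X n *\<^sub>v \<beta>;
        R = averaging_risk (\<Omega> n) (\<epsilon> n) (X n) (\<M> n) \<mu>;
        \<phi>bar = (MAX m\<in>{1..card (\<M> n)}. 2 * \<phi> n m + 16 / (real (block_len (\<M> n) m) * \<phi> n m))
    in \<exists>w \<in> relaxed_weights (\<M> n).
         (\<forall>v \<in> relaxed_weights (\<M> n). R w \<le> R v) \<and>
         (\<integral>\<omega>. sq_norm (stein_fit \<sigma> (\<phi> n) (X n) (\<M> n) (\<mu> + \<epsilon> n \<omega>) - \<mu>) \<partial>\<Omega> n)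
           \<le> (1 + \<phi>bar) * R w + 8 * c\<^sub>1 * \<sigma>\<^sup>2"
    unfolding Let_def
    using oracle_weight_relaxed oracle_optimal[OF noise]
      stein_oracle_inequality[OF noise penalty[OF n] cond_ii[OF n] B B_nonneg cond_i[OF n]]
    by blast
qed

end
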